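(* Let $\Omega\subset\mathbb{C}$ be a bounded simply connected domain, let $a,b\in L_\infty(\Omega;\mathbb{B})$, and let $1<p\leqslant\infty$. Then the Vekua-Bergman space $\mathcal{A}_{(a,b)}^p(\Omega;\mathbb{B})$, equipped with the $L_p(\Omega;\mathbb{B})$-norm, is a (complex) Banach space, and for $1<p<\infty$ it is separable and reflexive. In particular, $\mathcal{A}_{(a,b)}^2(\Omega;\mathbb{B})$ is a separable complex Hilbert space with the inner product of $L_2(\Omega;\mathbb{B})$.
   Context: $\mathbb{B}=\{u+\mathbf{j}v : u,v\in\mathbb{C}\}$ is the commutative $\mathbb{C}$-algebra of bicomplex numbers, with $\mathbf{j}^2=-1$ and $i\mathbf{j}=\mathbf{j}i$. For $W=u+\mathbf{j}v$: $\operatorname{Sc}W=u$, $\operatorname{Vec}W=v$, $\overline{W}=u-\mathbf{j}v$, $|W|_{\mathbb{B}}=\sqrt{|u|^2+|v|^2}$. With $^*$ the complex conjugation, $\langle W,V\rangle_{\mathbb{B}}=(\operatorname{Sc}W)(\operatorname{Sc}V)^*+(\operatorname{Vec}W)(\operatorname{Vec}V)^*$. A function $F:\Omega\to\mathbb{B}$ belongs to $\mathscr{F}(\Omega;\mathbb{B})$ (for a space $\mathscr{F}(\Omega)$ of complex-valued functions) iff $\operatorname{Sc}F,\operatorname{Vec}F\in\mathscr{F}(\Omega)$. $L_p(\Omega;\mathbb{B})$ has norm $\left(\iint_\Omega|F|_{\mathbb{B}}^p\,dA\right)^{1/p}$ (essential supremum of $|F|_{\mathbb{B}}$ if $p=\infty$),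 and $\langle F,G\rangle_{L_2(\Omega;\mathbb{B})}=\iint_\Omega\langle F(z),G(z)\rangle_{\mathbb{B}}\,dA_z$. With $z=x+iy$, $\overline{\boldsymbol{\partial}}=\frac12\left(\frac{\partial}{\partial x}+\mathbf{j}\frac{\partial}{\partial y}\right)$. A function $V\in L_{1,loc}(\Omega;\mathbb{B})$ is the weak $\overline{\boldsymbol{\partial}}$-derivative of $W\in L_p(\Omega;\mathbb{B})$ if $\iint_\Omega W\,\overline{\boldsymbol{\partial}}\phi\,dA=-\iint_\Omega V\phi\,dA$ for all $\phi\in C_0^\infty(\Omega;\mathbb{B})$. The Vekua-Bergman space $\mathcal{A}_{(a,b)}^p(\Omega;\mathbb{B})$ is the set of all $W\in L_p(\Omega;\mathbb{B})$ satisfying $\overline{\boldsymbol{\partial}}W=aW+b\overline{W}$ in $\Omega$ in the weak sense. *)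

theory Defs
  imports "HOL-Analysis.Analysis" "HOL-Probability.Essential_Supremum"
begin

section \<open>Bicomplex numbers\<close>

text \<open>\<open>Bicomplex u v\<close> stands for \<open>u + j v\<close>, where \<open>j\<close> is a second imaginary unit which commutes
  with \<open>\<i>\<close>.\<close>

codatatype bicomplex = Bicomplex (Sc: complex) (Vec: complex)

lemma bicomplex_eqI: "Sc W = Sc V \<Longrightarrow> Vec W = Vec V \<Longrightarrow> W = V"
  by (rule bicomplex.expand) simp

lemma bicomplex_eq_iff: "W = V \<longleftrightarrow> Sc W = Sc V \<and> Vec W = Vec V"
  by (auto intro: bicomplex_eqI)

instantiation bicomplex :: comm_ring_1
begin

primcorec zero_bicomplex where
  "Sc 0 = 0"
| "Vec 0 = 0"

primcorec one_bicomplex where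
  "Sc 1 = 1"
| "Vec 1 = 0"

primcorec plus_bicomplex where
  "Sc (W + V) = Sc W + Sc V"
| "Vec (W + V) = Vec W + Vec V"

primcorec uminus_bicomplex where
  "Sc (- W) = - Sc W"
| "Vec (- W) = - Vec W"

primcorec minus_bicomplex where
  "Sc (W - V) = Sc W - Sc V"
| "Vec (W - V) = Vec W - Vec V"

primcorec times_bicomplex where
  "Sc (W * V) = Sc W * Sc V - Vec W * Vec V"
| "Vec (W * V) = Sc W * Vec V + Vec W * Sc V"

instance
  by standard (auto simp: bicomplex_eq_iff algebra_simps)

end

instantiation bicomplex :: real_algebra_1
begin

primcorec scaleR_bicomplex where
  "Sc (r *\<^sub>R W) = r *\<^sub>R Sc W"
| "Vec (r *\<^sub>R W) = r *\<^sub>R Vec W"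

instance
  by standard (simp_all add: bicomplex_eq_iff algebra_simps)

end

instantiation bicomplex :: real_inner
begin

definition "inner W V = inner (Sc W) (Sc V) + inner (Vec W) (Vec V)" for W V :: bicomplex

definition "norm W = sqrt ((cmod (Sc W))\<^sup>2 + (cmod (Vec W))\<^sup>2)" for W :: bicomplex

definition "sgn W = W /\<^sub>R norm W" for W :: bicomplex

definition "dist W V = norm (W - V)" for W V :: bicomplex

definition
  "(uniformity :: (bicomplex \<times> bicomplex) filter) = (INF e\<in>{0<..}. principal {(x, y). dist x y < e})"

definition
  "open (U :: bicomplex set) \<longleftrightarrow> (\<forall>x\<in>U. eventually (\<lambda>(x', y). x' = x \<longrightarrow> y \<in> U) uniformity)"

instance
proof
  fix W V Z :: bicomplex and U :: "bicomplex set" and r :: real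
  show "dist W V = norm (W - V)" "sgn W = W /\<^sub>R norm W"
    by (simp_all add: dist_bicomplex_def sgn_bicomplex_def)
  show "(uniformity :: (bicomplex \<times> bicomplex) filter) = (INF e\<in>{0<..}. principal {(x, y). dist x y < e})"
    "open U \<longleftrightarrow> (\<forall>x\<in>U. eventually (\<lambda>(x', y). x' = x \<longrightarrow> y \<in> U) uniformity)"
    by (rule uniformity_bicomplex_def open_bicomplex_def)+
  show "inner W V = inner V W" "inner (W + V) Z = inner W Z + inner V Z"
    "inner (r *\<^sub>R W) V = r * inner W V" "0 \<le> inner W W"
    by (simp_all add: inner_bicomplex_def inner_commute[of "Sc W" "Sc V"]
        inner_commute[of "Vec W" "Vec V"] inner_add_left distrib_left)
  show "inner W W = 0 \<longleftrightarrow> W = 0"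
    by (simp add: inner_bicomplex_def bicomplex_eq_iff add_nonneg_eq_0_iff)
  show "norm W = sqrt (inner W W)"
    by (simp add: norm_bicomplex_def inner_bicomplex_def power2_norm_eq_inner)
qed

end

instantiation bicomplex :: euclidean_space
begin

definition
  "Basis = {Bicomplex 1 0, Bicomplex \<i> 0, Bicomplex 0 1, Bicomplex 0 \<i>}"

instance
proof
  have *: "inner x (Bicomplex u v) = inner (Sc x) u + inner (Vec x) v" for x u v
    by (simp add: inner_bicomplex_def)
  show "(Basis :: bicomplex set) \<noteq> {}" "finite (Basis :: bicomplex set)"
    by (simp_all add: Basis_bicomplex_def)
  show "inner u v = (if u = v then 1 else 0)" if "u \<in> Basis" "v \<in> Basis" for u v :: bicomplex
    using that unfolding Basis_bicomplex_def by (elim insertE emptyE) (simp_all add: *)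
  have "(\<forall>u\<in>Basis. inner x u = 0) \<longleftrightarrow> Sc x = 0 \<and> Vec x = 0" for x :: bicomplex
    by (simp add: Basis_bicomplex_def * inner_complex_def complex_eq_iff conj_assoc)
  then show "(\<forall>u\<in>Basis. inner x u = 0) \<longleftrightarrow> x = 0" for x :: bicomplex
    by (simp add: bicomplex_eq_iff)
qed

end

definition bc_j :: bicomplex where
  "bc_j = Bicomplex 0 1"

definition bc_of_complex :: "complex \<Rightarrow> bicomplex" where
  "bc_of_complex c = Bicomplex c 0"

definition bc_cnj :: "bicomplex \<Rightarrow> bicomplex" where
  "bc_cnj W = Bicomplex (Sc W) (- Vec W)"

definition bc_inner :: "bicomplex \<Rightarrow> bicomplex \<Rightarrow> complex" where
  "bc_inner W V = Sc W * cnj (Sc V) + Vec W * cnj (Vec V)"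

lemma bicomplex_decompose: "W = bc_of_complex (Sc W) + bc_j * bc_of_complex (Vec W)"
  by (simp add: bicomplex_eq_iff bc_of_complex_def bc_j_def)

lemma bc_j_squared: "bc_j * bc_j = - 1"
  by (simp add: bicomplex_eq_iff bc_j_def)

lemma bc_inner_self: "bc_inner W W = of_real ((norm W)\<^sup>2)"
  by (simp add: bc_inner_def norm_bicomplex_def complex_norm_square[symmetric] del: of_real_power)


section \<open>Complex normed, Banach and Hilbert spaces on a carrier\<close>

text \<open>The function spaces below depend on a domain and an exponent and hence do not form types; a
  normed space is therefore given by an explicit carrier with explicit operations.\<close>

record 'a cnspace =
  ns_carrier :: "'a set"
  ns_zero :: 'a
  ns_add :: "'a \<Rightarrow> 'a \<Rightarrow> 'a"
  ns_scale :: "complex \<Rightarrow> 'a \<Rightarrow> 'a"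
  ns_norm :: "'a \<Rightarrow> real"

locale complex_vector_space =
  fixes X :: "'a cnspace"
  assumes zero_closed: "ns_zero X \<in> ns_carrier X"
    and add_closed: "\<lbrakk>x \<in> ns_carrier X; y \<in> ns_carrier X\<rbrakk> \<Longrightarrow> ns_add X x y \<in> ns_carrier X"
    and scale_closed: "x \<in> ns_carrier X \<Longrightarrow> ns_scale X c x \<in> ns_carrier X"
    and add_assoc: "\<lbrakk>x \<in> ns_carrier X; y \<in> ns_carrier X; z \<in> ns_carrier X\<rbrakk>
      \<Longrightarrow> ns_add X (ns_add X x y) z = ns_add X x (ns_add X y z)"
    and add_commute: "\<lbrakk>x \<in> ns_carrier X; y \<in> ns_carrier X\<rbrakk> \<Longrightarrow> ns_add X x y = ns_add X y x"
    and add_zero: "x \<in> ns_carrier X \<Longrightarrow> ns_add X x (ns_zero X) = x"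
    and add_inverse: "x \<in> ns_carrier X \<Longrightarrow> \<exists>y\<in>ns_carrier X. ns_add X x y = ns_zero X"
    and scale_add_right: "\<lbrakk>x \<in> ns_carrier X; y \<in> ns_carrier X\<rbrakk>
      \<Longrightarrow> ns_scale X c (ns_add X x y) = ns_add X (ns_scale X c x) (ns_scale X c y)"
    and scale_add_left: "x \<in> ns_carrier X
      \<Longrightarrow> ns_scale X (c + d) x = ns_add X (ns_scale X c x) (ns_scale X d x)"
    and scale_scale: "x \<in> ns_carrier X \<Longrightarrow> ns_scale X c (ns_scale X d x) = ns_scale X (c * d) x"
    and scale_one: "x \<in> ns_carrier X \<Longrightarrow> ns_scale X 1 x = x"

locale complex_normed_space = complex_vector_space +
  assumes norm_nonneg: "x \<in> ns_carrier X \<Longrightarrow> 0 \<le> ns_norm X x"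
    and norm_eq_zero: "x \<in> ns_carrier X \<Longrightarrow> ns_norm X x = 0 \<longleftrightarrow> x = ns_zero X"
    and norm_scale: "x \<in> ns_carrier X \<Longrightarrow> ns_norm X (ns_scale X c x) = cmod c * ns_norm X x"
    and norm_triangle: "\<lbrakk>x \<in> ns_carrier X; y \<in> ns_carrier X\<rbrakk>
      \<Longrightarrow> ns_norm X (ns_add X x y) \<le> ns_norm X x + ns_norm X y"

text \<open>The locale \<open>Metric_space\<close> requires nonnegativity and symmetry also outside the carrier, hence the
  value \<open>0\<close> there.\<close>

definition ns_dist :: "'a cnspace \<Rightarrow> 'a \<Rightarrow> 'a \<Rightarrow> real" where
  "ns_dist X x y =
    (if x \<in> ns_carrier X \<and> y \<in> ns_carrier X then ns_norm X (ns_add X x (ns_scale X (- 1) y)) else 0)"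

definition complex_banach_space :: "'a cnspace \<Rightarrow> bool" where
  "complex_banach_space X \<longleftrightarrow>
    complex_normed_space X \<and> Metric_space.mcomplete (ns_carrier X) (ns_dist X)"

definition ns_separable :: "'a cnspace \<Rightarrow> bool" where
  "ns_separable X \<longleftrightarrow> separable_space (Metric_space.mtopology (ns_carrier X) (ns_dist X))"

text \<open>Functionals are extensional (\<open>undefined\<close> off the carrier), so that equality in the dual space is
  equality of functionals on the carrier.\<close>

definition ns_dual :: "'a cnspace \<Rightarrow> ('a \<Rightarrow> complex) cnspace" where
  "ns_dual X =
    \<lparr>ns_carrier = {f \<in> extensional (ns_carrier X).
        (\<forall>x\<in>ns_carrier X. \<forall>y\<in>ns_carrier X. f (ns_add X x y) = f x + f y) \<and>
        (\<forall>c. \<forall>x\<in>ns_carrier X. f (ns_scale X c x) = c * f x) \<and>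
        (\<exists>B. \<forall>x\<in>ns_carrier X. cmod (f x) \<le> B * ns_norm X x)},
     ns_zero = (\<lambda>x\<in>ns_carrier X. 0),
     ns_add = (\<lambda>f g. \<lambda>x\<in>ns_carrier X. f x + g x),
     ns_scale = (\<lambda>c f. \<lambda>x\<in>ns_carrier X. c * f x),
     ns_norm = (\<lambda>f. SUP x\<in>{x \<in> ns_carrier X. ns_norm X x \<le> 1}. cmod (f x))\<rparr>"

definition ns_canonical_embedding :: "'a cnspace \<Rightarrow> 'a \<Rightarrow> ('a \<Rightarrow> complex) \<Rightarrow> complex" where
  "ns_canonical_embedding X x = (\<lambda>f\<in>ns_carrier (ns_dual X). f x)"

definition ns_reflexive :: "'a cnspace \<Rightarrow> bool" where
  "ns_reflexive X \<longleftrightarrow>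
    ns_canonical_embedding X ` ns_carrier X = ns_carrier (ns_dual (ns_dual X))"

locale complex_inner_product = complex_vector_space +
  fixes ip :: "'a \<Rightarrow> 'a \<Rightarrow> complex"
  assumes ip_add_left: "\<lbrakk>x \<in> ns_carrier X; y \<in> ns_carrier X; z \<in> ns_carrier X\<rbrakk>
      \<Longrightarrow> ip (ns_add X x y) z = ip x z + ip y z"
    and ip_scale_left: "\<lbrakk>x \<in> ns_carrier X; y \<in> ns_carrier X\<rbrakk> \<Longrightarrow> ip (ns_scale X c x) y = c * ip x y"
    and ip_commute: "\<lbrakk>x \<in> ns_carrier X; y \<in> ns_carrier X\<rbrakk> \<Longrightarrow> ip x y = cnj (ip y x)"
    and ip_nonneg: "x \<in> ns_carrier X \<Longrightarrow> 0 \<le> Re (ip x x)"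
    and ip_eq_zero: "x \<in> ns_carrier X \<Longrightarrow> ip x x = 0 \<longleftrightarrow> x = ns_zero X"

definition complex_hilbert_space :: "'a cnspace \<Rightarrow> ('a \<Rightarrow> 'a \<Rightarrow> complex) \<Rightarrow> bool" where
  "complex_hilbert_space X ip \<longleftrightarrow>
    complex_inner_product X ip \<and>
    (\<forall>x\<in>ns_carrier X. ns_norm X x = sqrt (Re (ip x x))) \<and>
    complex_banach_space X"


section \<open>Spaces of bicomplex-valued functions\<close>

text \<open>Functions on \<open>\<Omega>\<close> are functions on the whole type whose values outside \<open>\<Omega>\<close> are irrelevant;
  only the test functions below are globally defined, being extended by \<open>0\<close>.\<close>

definition bc_valued :: "(complex \<Rightarrow> complex) set \<Rightarrow> (complex \<Rightarrow> bicomplex) set" where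
  "bc_valued S = {F. (\<lambda>z. Sc (F z)) \<in> S \<and> (\<lambda>z. Vec (F z)) \<in> S}"

definition Lp_fun :: "ennreal \<Rightarrow> 'a measure \<Rightarrow> ('a \<Rightarrow> 'b::real_normed_vector) set" where
  "Lp_fun p M = {f \<in> borel_measurable M.
    if p = \<infinity> then esssup M (\<lambda>x. ennreal (norm (f x))) < \<infinity>
    else integrable M (\<lambda>x. norm (f x) powr enn2real p)}"

definition Lp_norm :: "ennreal \<Rightarrow> 'a measure \<Rightarrow> ('a \<Rightarrow> 'b::real_normed_vector) \<Rightarrow> real" where
  "Lp_norm p M f =
    (if p = \<infinity> then enn2real (esssup M (\<lambda>x. ennreal (norm (f x))))
     else (LINT x|M. norm (f x) powr enn2real p) powr (1 / enn2real p))"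

definition L1_loc :: "complex set \<Rightarrow> (complex \<Rightarrow> complex) set" where
  "L1_loc \<Omega> = {f. \<forall>K. compact K \<and> K \<subseteq> \<Omega> \<longrightarrow> integrable (lebesgue_on K) f}"

subsection \<open>Classes modulo equality almost everywhere\<close>

definition ae_class :: "'a measure \<Rightarrow> ('a \<Rightarrow> 'b::real_normed_vector) \<Rightarrow> ('a \<Rightarrow> 'b) set" where
  "ae_class M f = {g \<in> borel_measurable M. AE x in M. g x = f x}"

definition ae_rep :: "('a \<Rightarrow> 'b) set \<Rightarrow> 'a \<Rightarrow> 'b" where
  "ae_rep C = (SOME f. f \<in> C)"

definition bc_Lp :: "ennreal \<Rightarrow> complex set \<Rightarrow> (complex \<Rightarrow> bicomplex) set cnspace" where
  "bc_Lp p \<Omega> =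
    \<lparr>ns_carrier = ae_class (lebesgue_on \<Omega>) ` bc_valued (Lp_fun p (lebesgue_on \<Omega>)),
     ns_zero = ae_class (lebesgue_on \<Omega>) (\<lambda>z. 0),
     ns_add = (\<lambda>C D. ae_class (lebesgue_on \<Omega>) (\<lambda>z. ae_rep C z + ae_rep D z)),
     ns_scale = (\<lambda>c C. ae_class (lebesgue_on \<Omega>) (\<lambda>z. bc_of_complex c * ae_rep C z)),
     ns_norm = (\<lambda>C. Lp_norm p (lebesgue_on \<Omega>) (ae_rep C))\<rparr>"

definition bc_L2_inner ::
    "complex set \<Rightarrow> (complex \<Rightarrow> bicomplex) set \<Rightarrow> (complex \<Rightarrow> bicomplex) set \<Rightarrow> complex" where
  "bc_L2_inner \<Omega> C D = (LINT z|lebesgue_on \<Omega>. bc_inner (ae_rep C z) (ae_rep D z))"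

subsection \<open>Test functions and the weak derivative\<close>

definition partial_x :: "(complex \<Rightarrow> 'b::real_normed_vector) \<Rightarrow> complex \<Rightarrow> 'b" where
  "partial_x f z = vector_derivative (\<lambda>t. f (z + of_real t)) (at 0)"

definition partial_y :: "(complex \<Rightarrow> 'b::real_normed_vector) \<Rightarrow> complex \<Rightarrow> 'b" where
  "partial_y f z = vector_derivative (\<lambda>t. f (z + \<i> * of_real t)) (at 0)"

primrec C_k :: "nat \<Rightarrow> (complex \<Rightarrow> 'b::real_normed_vector) \<Rightarrow> bool" where
  "C_k 0 f \<longleftrightarrow> continuous_on UNIV f"
| "C_k (Suc k) f \<longleftrightarrow>
    (\<forall>z. (\<lambda>t::real. f (z + of_real t)) differentiable (at 0)) \<and>
    (\<forall>z. (\<lambda>t::real. f (z + \<i> * of_real t)) differentiable (at 0)) \<and>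
    C_k k (partial_x f) \<and> C_k k (partial_y f)"

definition C0_infinity :: "complex set \<Rightarrow> (complex \<Rightarrow> complex) set" where
  "C0_infinity \<Omega> = {\<phi>. (\<forall>k. C_k k \<phi>) \<and>
    compact (closure {z. \<phi> z \<noteq> 0}) \<and> closure {z. \<phi> z \<noteq> 0} \<subseteq> \<Omega>}"

definition bc_dbar :: "(complex \<Rightarrow> bicomplex) \<Rightarrow> complex \<Rightarrow> bicomplex" where
  "bc_dbar \<phi> z = (1 / 2) *\<^sub>R (partial_x \<phi> z + bc_j * partial_y \<phi> z)"

definition is_weak_bc_dbar ::
    "complex set \<Rightarrow> (complex \<Rightarrow> bicomplex) \<Rightarrow> (complex \<Rightarrow> bicomplex) \<Rightarrow> bool" where
  "is_weak_bc_dbar \<Omega> W V \<longleftrightarrow> V \<in> bc_valued (L1_loc \<Omega>) \<and>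
    (\<forall>\<phi>\<in>bc_valued (C0_infinity \<Omega>).
      (LINT z|lebesgue_on \<Omega>. W z * bc_dbar \<phi> z) = - (LINT z|lebesgue_on \<Omega>. V z * \<phi> z))"

subsection \<open>The Vekua-Bergman space\<close>

definition vekua_bergman_functions ::
    "ennreal \<Rightarrow> (complex \<Rightarrow> bicomplex) \<Rightarrow> (complex \<Rightarrow> bicomplex) \<Rightarrow> complex set
      \<Rightarrow> (complex \<Rightarrow> bicomplex) set" where
  "vekua_bergman_functions p a b \<Omega> = {W \<in> bc_valued (Lp_fun p (lebesgue_on \<Omega>)).
    is_weak_bc_dbar \<Omega> W (\<lambda>z. a z * W z + b z * bc_cnj (W z))}"

definition vekua_bergman ::
    "ennreal \<Rightarrow> (complex \<Rightarrow> bicomplex) \<Rightarrow> (complex \<Rightarrow> bicomplex) \<Rightarrow> complex set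
      \<Rightarrow> (complex \<Rightarrow> bicomplex) set cnspace" where
  "vekua_bergman p a b \<Omega> = (bc_Lp p \<Omega>)
    \<lparr>ns_carrier := ae_class (lebesgue_on \<Omega>) ` vekua_bergman_functions p a b \<Omega>\<rparr>"

subsection \<open>Independence of representatives\<close>

lemma ae_class_eqI:
  assumes "AE x in M. f x = g x"
  shows "ae_class M f = ae_class M g"
proof -
  have "(AE x in M. h x = f x) \<longleftrightarrow> (AE x in M. h x = g x)" for h
  proof
    assume "AE x in M. h x = f x"
    then show "AE x in M. h x = g x" using assms by eventually_elim simp
  next
    assume "AE x in M. h x = g x"
    then show "AE x in M. h x = f x" using assms by eventually_elim simp
  qed
  then show ?thesis by (simp add: ae_class_def)
qed

lemma ae_rep_ae_class:
  assumes "f \<in> borel_measurable M"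
  shows "ae_rep (ae_class M f) \<in> borel_measurable M" "AE x in M. ae_rep (ae_class M f) x = f x"
proof -
  have "f \<in> ae_class M f" using assms by (simp add: ae_class_def)
  then have "ae_rep (ae_class M f) \<in> ae_class M f"
    unfolding ae_rep_def by (rule someI[of "\<lambda>g. g \<in> ae_class M f"])
  then show "ae_rep (ae_class M f) \<in> borel_measurable M" "AE x in M. ae_rep (ae_class M f) x = f x"
    by (simp_all add: ae_class_def)
qed

lemma ae_class_eq_iff:
  assumes "f \<in> borel_measurable M"
  shows "ae_class M f = ae_class M g \<longleftrightarrow> (AE x in M. f x = g x)"
proof
  assume "ae_class M f = ae_class M g"
  moreover have "f \<in> ae_class M f" using assms by (simp add: ae_class_def)
  ultimately show "AE x in M. f x = g x" by (simp add: ae_class_def)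
qed (rule ae_class_eqI)

lemma Lp_norm_cong_AE:
  assumes "f \<in> borel_measurable M" "g \<in> borel_measurable M" "AE x in M. f x = g x"
  shows "Lp_norm p M f = Lp_norm p M g"
proof -
  have [measurable]: "f \<in> borel_measurable M" "g \<in> borel_measurable M" by fact+
  have "AE x in M. ennreal (norm (f x)) = ennreal (norm (g x))"
    using assms(3) by eventually_elim simp
  then have "esssup M (\<lambda>x. ennreal (norm (f x))) = esssup M (\<lambda>x. ennreal (norm (g x)))"
    by (intro esssup_AE_cong) auto
  moreover have "(LINT x|M. norm (f x) powr enn2real p) = (LINT x|M. norm (g x) powr enn2real p)"
    by (rule integral_cong_AE) (use assms(3) in auto)
  ultimately show ?thesis by (simp add: Lp_norm_def)
qed

lemma bc_Lp_ae_class: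
  assumes "F \<in> borel_measurable (lebesgue_on \<Omega>)" "G \<in> borel_measurable (lebesgue_on \<Omega>)"
  shows "ns_add (bc_Lp p \<Omega>) (ae_class (lebesgue_on \<Omega>) F) (ae_class (lebesgue_on \<Omega>) G)
      = ae_class (lebesgue_on \<Omega>) (\<lambda>z. F z + G z)"
    and "ns_scale (bc_Lp p \<Omega>) c (ae_class (lebesgue_on \<Omega>) F)
      = ae_class (lebesgue_on \<Omega>) (\<lambda>z. bc_of_complex c * F z)"
    and "ns_norm (bc_Lp p \<Omega>) (ae_class (lebesgue_on \<Omega>) F) = Lp_norm p (lebesgue_on \<Omega>) F"
proof -
  define M where "M = lebesgue_on \<Omega>"
  have F: "ae_rep (ae_class M F) \<in> borel_measurable M" "AE z in M. ae_rep (ae_class M F) z = F z"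
    and G: "AE z in M. ae_rep (ae_class M G) z = G z"
    using assms ae_rep_ae_class unfolding M_def by blast+
  have "AE z in M. ae_rep (ae_class M F) z + ae_rep (ae_class M G) z = F z + G z"
    using F(2) G by eventually_elim simp
  from ae_class_eqI[OF this]
  show "ns_add (bc_Lp p \<Omega>) (ae_class (lebesgue_on \<Omega>) F) (ae_class (lebesgue_on \<Omega>) G)
      = ae_class (lebesgue_on \<Omega>) (\<lambda>z. F z + G z)"
    by (simp add: bc_Lp_def M_def)
  have "AE z in M. bc_of_complex c * ae_rep (ae_class M F) z = bc_of_complex c * F z"
    using F(2) by eventually_elim simp
  from ae_class_eqI[OF this]
  show "ns_scale (bc_Lp p \<Omega>) c (ae_class (lebesgue_on \<Omega>) F)
      = ae_class (lebesgue_on \<Omega>) (\<lambda>z. bc_of_complex c * F z)"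
    by (simp add: bc_Lp_def M_def)
  show "ns_norm (bc_Lp p \<Omega>) (ae_class (lebesgue_on \<Omega>) F) = Lp_norm p (lebesgue_on \<Omega>) F"
    using Lp_norm_cong_AE[OF F(1) _ F(2)] assms(1) by (simp add: bc_Lp_def M_def)
qed

end

theory Submission
  imports Defs
begin

text \<open>The Vekua equation is, for each test function, the vanishing of a complex-linear,
  bicomplex-valued functional of \<open>W\<close> which is bounded for the norm of \<open>L\<^sub>1\<close>: \<open>a\<close> and \<open>b\<close> are
  essentially bounded, conjugation with respect to \<open>j\<close> is linear over the complex numbers, and
  the test function and its derivative are bounded. As \<open>\<Omega>\<close> has finite measure, convergence in
  \<open>L\<^sub>p\<close> implies convergence in \<open>L\<^sub>1\<close>, so the solutions form a closed subspace of \<open>L\<^sub>p\<close>.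
  Completeness and separability pass from \<open>L\<^sub>p\<close> to closed subspaces, and so does uniform
  convexity, which yields reflexivity by the Milman--Pettis theorem; the dual of \<open>L\<^sub>p\<close> is never
  needed.\<close>

section \<open>Reflexivity of uniformly convex spaces\<close>

text \<open>An element \<open>\<xi>\<close> of the bidual is tested against only two functionals at
  a time: one that nearly norms \<open>\<xi>\<close>, and one arbitrary. Helly's condition for a
  pair lives in \<complex>^2, where a point is separated from a closed convex set by
  finite-dimensional means, so no functional on the space itself has to be constructed. The exponent
  p = infinity is why completeness is routed through L_1: on a set of finite measure a fast
  subsequence converges almost everywhere for every exponent, and lower semicontinuity of the norm
  then returns to L_p. Uniform convexity is the integral of a pointwise inequality in the target
  space. Bicomplex numbers form a Euclidean space, so compactness of a sphere supplies the constant
  in that inequality, uniformly in the functions. The spaces consist of classes modulo null sets,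
  whereas the estimates concern functions. A subspace is therefore described by a set of functions
  that is closed under limits in L_p; identities for classes are read off from pointwise
  ones.\<close>

context complex_vector_space
begin

definition sub :: "'a \<Rightarrow> 'a \<Rightarrow> 'a" where
  "sub x y = ns_add X x (ns_scale X (- 1) y)"

lemma sub_closed: "x \<in> ns_carrier X \<Longrightarrow> y \<in> ns_carrier X \<Longrightarrow> sub x y \<in> ns_carrier X"
  by (simp add: sub_def add_closed scale_closed)

lemma zero_add: "x \<in> ns_carrier X \<Longrightarrow> ns_add X (ns_zero X) x = x"
  by (metis add_commute add_zero zero_closed)

lemma add_left_cancel:
  assumes "x \<in> ns_carrier X" "y \<in> ns_carrier X" "z \<in> ns_carrier X" "ns_add X x y = ns_add X x z"
  shows "y = z"
proof -
  obtain w where w: "w \<in> ns_carrier X" "ns_add X x w = ns_zero X"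
    using add_inverse assms(1) by blast
  have "ns_add X w (ns_add X x y) = y" if "y \<in> ns_carrier X" for y
    using w assms(1) that by (metis add_assoc add_commute zero_add)
  then show ?thesis using assms by metis
qed

lemma scale_zero_left: "x \<in> ns_carrier X \<Longrightarrow> ns_scale X 0 x = ns_zero X"
  by (metis add_left_cancel add_zero scale_add_left scale_closed zero_closed add.right_neutral)

lemma sub_self: "x \<in> ns_carrier X \<Longrightarrow> sub x x = ns_zero X"
  using scale_add_left[of x 1 "- 1"] by (simp add: sub_def scale_one scale_zero_left)

text \<open>The telescoping identity behind the triangle inequality of
  \<open>ns_dist\<close>.\<close>

lemma sub_add_sub:
  assumes "x \<in> ns_carrier X" "y \<in> ns_carrier X" "z \<in> ns_carrier X"
  shows "ns_add X (sub x y) (sub y z) = sub x z"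
proof -
  have "ns_add X (ns_scale X (- 1) y) (sub y z) = ns_add X (sub y y) (ns_scale X (- 1) z)"
    unfolding sub_def using assms by (metis add_assoc add_commute scale_closed)
  also have "\<dots> = ns_scale X (- 1) z"
    using assms by (simp add: sub_self zero_add scale_closed)
  finally show ?thesis
    using assms by (simp add: sub_def add_assoc add_closed scale_closed)
qed

lemma sub_eq_zero_iff:
  assumes "x \<in> ns_carrier X" "y \<in> ns_carrier X"
  shows "sub x y = ns_zero X \<longleftrightarrow> x = y"
  by (metis add_left_cancel assms add_commute scale_closed sub_def sub_self)

lemma scale_sub:
  assumes "x \<in> ns_carrier X" "y \<in> ns_carrier X"
  shows "ns_scale X (- 1) (sub x y) = sub y x"
  using assms by (simp add: sub_def scale_add_right scale_closed scale_scale scale_one add_commute)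

end

section \<open>Metric, unit ball and dual of a complex normed space\<close>

context complex_normed_space
begin

lemma ns_dist_eq: "x \<in> ns_carrier X \<Longrightarrow> y \<in> ns_carrier X \<Longrightarrow> ns_dist X x y = ns_norm X (sub x y)"
  by (simp add: ns_dist_def sub_def)

lemma Metric_space_ns_dist: "Metric_space (ns_carrier X) (ns_dist X)"
proof
  fix x y z
  show "0 \<le> ns_dist X x y"
    by (auto simp: ns_dist_def norm_nonneg add_closed scale_closed)
  show "ns_dist X x y = ns_dist X y x"
  proof (cases "x \<in> ns_carrier X \<and> y \<in> ns_carrier X")
    case True
    then show ?thesis
      using norm_scale[of "sub y x" "- 1"] by (simp add: ns_dist_eq scale_sub sub_closed)
  qed (auto simp: ns_dist_def)
  assume x: "x \<in> ns_carrier X" and y: "y \<in> ns_carrier X"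
  show "ns_dist X x y = 0 \<longleftrightarrow> x = y"
    using x y by (simp add: ns_dist_eq norm_eq_zero sub_closed sub_eq_zero_iff)
  assume z: "z \<in> ns_carrier X"
  show "ns_dist X x z \<le> ns_dist X x y + ns_dist X y z"
    using norm_triangle[of "sub x y" "sub y z"] x y z by (simp add: ns_dist_eq sub_add_sub sub_closed)
qed

sublocale metric: Metric_space "ns_carrier X" "ns_dist X"
  by (rule Metric_space_ns_dist)

lemma norm_zero: "ns_norm X (ns_zero X) = 0"
  by (simp add: norm_eq_zero zero_closed)

definition ns_ball :: "'a set" where
  "ns_ball = {x \<in> ns_carrier X. ns_norm X x \<le> 1}"

abbreviation dual :: "('a \<Rightarrow> complex) set" where
  "dual \<equiv> ns_carrier (ns_dual X)"

abbreviation dual_norm :: "('a \<Rightarrow> complex) \<Rightarrow> real" where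
  "dual_norm \<equiv> ns_norm (ns_dual X)"

lemma zero_in_ball: "ns_zero X \<in> ns_ball"
  by (simp add: ns_ball_def zero_closed norm_zero)

lemma scale_in_ball: "x \<in> ns_ball \<Longrightarrow> cmod c \<le> 1 \<Longrightarrow> ns_scale X c x \<in> ns_ball"
  by (auto simp: ns_ball_def scale_closed norm_scale norm_nonneg intro: mult_le_one)

lemma dual_add: "f \<in> dual \<Longrightarrow> x \<in> ns_carrier X \<Longrightarrow> y \<in> ns_carrier X \<Longrightarrow> f (ns_add X x y) = f x + f y"
  by (simp add: ns_dual_def)

lemma dual_scale: "f \<in> dual \<Longrightarrow> x \<in> ns_carrier X \<Longrightarrow> f (ns_scale X c x) = c * f x"
  by (simp add: ns_dual_def)

lemma dual_zero: "f \<in> dual \<Longrightarrow> f (ns_zero X) = 0"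
  using dual_scale[of f "ns_zero X" 0] zero_closed by (simp add: scale_zero_left)

lemma dual_sub: "f \<in> dual \<Longrightarrow> x \<in> ns_carrier X \<Longrightarrow> y \<in> ns_carrier X \<Longrightarrow> f (sub x y) = f x - f y"
  by (simp add: sub_def dual_add dual_scale scale_closed)

lemma dual_norm_eq: "dual_norm f = (SUP x\<in>ns_ball. cmod (f x))"
  by (simp add: ns_dual_def ns_ball_def)

lemma dual_norm_le: "(\<And>x. x \<in> ns_ball \<Longrightarrow> cmod (f x) \<le> s) \<Longrightarrow> dual_norm f \<le> s"
  unfolding dual_norm_eq using zero_in_ball by (intro cSUP_least) auto

lemma dual_le_norm_ball:
  assumes "f \<in> dual" "x \<in> ns_ball"
  shows "cmod (f x) \<le> dual_norm f"
proof -
  obtain B where B: "\<And>x. x \<in> ns_carrier X \<Longrightarrow> cmod (f x) \<le> B * ns_norm X x"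
    using assms(1) unfolding ns_dual_def by force
  \<comment> \<open>The constant \<open>B\<close> carries no sign, hence the absolute value.
    Boundedness is what gives the real supremum in the dual norm its meaning.\<close>
  have "cmod (f y) \<le> \<bar>B\<bar>" if "y \<in> ns_ball" for y
  proof -
    have y: "y \<in> ns_carrier X" "ns_norm X y \<le> 1" using that by (auto simp: ns_ball_def)
    have "B * ns_norm X y \<le> \<bar>B\<bar> * 1"
      using y norm_nonneg by (intro mult_mono) auto
    then show ?thesis using B[OF y(1)] by simp
  qed
  then have "bdd_above ((\<lambda>x. cmod (f x)) ` ns_ball)" by (auto simp: bdd_above_def)
  then show ?thesis unfolding dual_norm_eq using assms(2) by (rule cSUP_upper2) simp
qed

lemma dual_norm_nonneg: "f \<in> dual \<Longrightarrow> 0 \<le> dual_norm f"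
  using dual_le_norm_ball[OF _ zero_in_ball, of f] by (simp add: dual_zero)

text \<open>Homogeneity reduces the claim to the unit ball. A vector of norm 0 cannot be rescaled,
  but it is the zero vector, where \<open>f\<close> vanishes.\<close>

lemma dual_le_norm:
  assumes "f \<in> dual" "x \<in> ns_carrier X"
  shows "cmod (f x) \<le> dual_norm f * ns_norm X x"
proof (cases "ns_norm X x = 0")
  case True
  then show ?thesis using assms by (simp add: norm_eq_zero dual_zero norm_zero)
next
  case False
  then have pos: "0 < ns_norm X x" using norm_nonneg[OF assms(2)] by simp
  let ?c = "of_real (1 / ns_norm X x) :: complex"
  have c: "cmod ?c = 1 / ns_norm X x" using pos by (simp only: norm_of_real) simp
  have "ns_scale X ?c x \<in> ns_ball"
    unfolding ns_ball_def using assms pos by (simp add: scale_closed norm_scale c del: of_real_divide)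
  from dual_le_norm_ball[OF assms(1) this] show ?thesis
    using pos by (simp add: dual_scale assms norm_mult c field_simps del: of_real_divide)
qed

lemma dual_add_closed:
  assumes f: "f \<in> dual" and g: "g \<in> dual"
  shows "ns_add (ns_dual X) f g \<in> dual"
proof -
  have "cmod (f x + g x) \<le> (dual_norm f + dual_norm g) * ns_norm X x" if "x \<in> ns_carrier X" for x
    using norm_triangle_ineq[of "f x" "g x"] dual_le_norm[OF f that] dual_le_norm[OF g that]
    by (simp add: distrib_right)
  then have "\<exists>B. \<forall>x\<in>ns_carrier X. cmod (f x + g x) \<le> B * ns_norm X x" by blast
  then show ?thesis
    using dual_add[OF f] dual_add[OF g] dual_scale[OF f] dual_scale[OF g]
    by (simp add: ns_dual_def add_closed scale_closed algebra_simps)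
qed

lemma dual_scale_closed:
  assumes f: "f \<in> dual"
  shows "ns_scale (ns_dual X) c f \<in> dual"
proof -
  have "cmod (c * f x) \<le> (cmod c * dual_norm f) * ns_norm X x" if "x \<in> ns_carrier X" for x
    using mult_left_mono[OF dual_le_norm[OF f that], of "cmod c"] by (simp add: norm_mult mult.assoc)
  then have "\<exists>B. \<forall>x\<in>ns_carrier X. cmod (c * f x) \<le> B * ns_norm X x" by blast
  then show ?thesis
    using dual_add[OF f] dual_scale[OF f]
    by (simp add: ns_dual_def add_closed scale_closed algebra_simps)
qed

lemma dual_add_apply: "x \<in> ns_carrier X \<Longrightarrow> ns_add (ns_dual X) f g x = f x + g x"
  by (simp add: ns_dual_def)

lemma dual_scale_apply: "x \<in> ns_carrier X \<Longrightarrow> ns_scale (ns_dual X) c f x = c * f x"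
  by (simp add: ns_dual_def)

lemma ball_subset: "x \<in> ns_ball \<Longrightarrow> x \<in> ns_carrier X"
  by (simp add: ns_ball_def)

lemma dual_norm_scale_le:
  assumes "f \<in> dual"
  shows "dual_norm (ns_scale (ns_dual X) c f) \<le> cmod c * dual_norm f"
  by (rule dual_norm_le)
    (simp add: dual_scale_apply ball_subset norm_mult dual_le_norm_ball[OF assms] mult_left_mono)

lemma convex_ball:
  assumes "x \<in> ns_ball" "y \<in> ns_ball" "0 \<le> u" "0 \<le> v" "u + v = (1::real)"
  shows "ns_add X (ns_scale X (of_real u) x) (ns_scale X (of_real v) y) \<in> ns_ball"
proof -
  have xy: "x \<in> ns_carrier X" "y \<in> ns_carrier X" "ns_norm X x \<le> 1" "ns_norm X y \<le> 1"
    using assms by (auto simp: ns_ball_def)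
  have "ns_norm X (ns_add X (ns_scale X (of_real u) x) (ns_scale X (of_real v) y))
      \<le> u * ns_norm X x + v * ns_norm X y"
    using norm_triangle[of "ns_scale X (of_real u) x" "ns_scale X (of_real v) y"] assms xy
    by (simp add: scale_closed norm_scale)
  also have "\<dots> \<le> 1" using convex_bound_le[OF xy(3,4) assms(3,4,5)] .
  finally show ?thesis using xy by (simp add: ns_ball_def add_closed scale_closed)
qed

text \<open>Helly's condition for two functionals: a point of \<open>\<complex>\<^sup>2\<close> outside the closure of the image of the
  unit ball would be separated from it by a complex combination \<open>h\<close> of \<open>f\<close> and \<open>g\<close>, and
  \<open>\<bar>\<xi> h\<bar>\<close> would exceed the norm of \<open>h\<close>.\<close>

lemma Helly_pair:
  assumes add: "\<And>f g. f \<in> dual \<Longrightarrow> g \<in> dual \<Longrightarrow> \<xi> (ns_add (ns_dual X) f g) = \<xi> f + \<xi> g"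
    and scale: "\<And>c f. f \<in> dual \<Longrightarrow> \<xi> (ns_scale (ns_dual X) c f) = c * \<xi> f"
    and bound: "\<And>f. f \<in> dual \<Longrightarrow> cmod (\<xi> f) \<le> dual_norm f"
    and f: "f \<in> dual" and g: "g \<in> dual" and "0 < e"
  obtains x where "x \<in> ns_ball" "cmod (f x - \<xi> f) < e" "cmod (g x - \<xi> g) < e"
proof -
  define S where "S = (\<lambda>x. (f x, g x)) ` ns_ball"
  have "convex S"
  proof (rule convexI)
    fix p q :: "complex \<times> complex" and u v :: real
    assume "p \<in> S" "q \<in> S" and uv: "0 \<le> u" "0 \<le> v" "u + v = 1"
    then obtain x y where xy: "x \<in> ns_ball" "y \<in> ns_ball" "p = (f x, g x)" "q = (f y, g y)"
      by (auto simp: S_def)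
    have "u *\<^sub>R p + v *\<^sub>R q = (\<lambda>x. (f x, g x)) (ns_add X (ns_scale X (of_real u) x) (ns_scale X (of_real v) y))"
      using xy f g by (simp add: dual_add dual_scale ball_subset scale_closed scaleR_conv_of_real)
    then show "u *\<^sub>R p + v *\<^sub>R q \<in> S"
      unfolding S_def using convex_ball[OF xy(1,2) uv] by blast
  qed
  have "(\<xi> f, \<xi> g) \<in> closure S"
  proof (rule ccontr)
    assume "(\<xi> f, \<xi> g) \<notin> closure S"
    then obtain w s where w: "inner w (\<xi> f, \<xi> g) < s" "\<And>p. p \<in> closure S \<Longrightarrow> s < inner w p"
      using separating_hyperplane_closed_point[of "closure S"] \<open>convex S\<close> by (meson closed_closure convex_closure)
    obtain \<alpha> \<beta> where \<alpha>\<beta>: "w = (\<alpha>, \<beta>)" by (cases w)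
    \<comment> \<open>The real inner product of \<complex>^2 is the real part of the Hermitian one,
      hence the conjugates: the separating functional \<open>inner w\<close> becomes the real part
      of \<open>h\<close>.\<close>
    define h where "h = ns_add (ns_dual X) (ns_scale (ns_dual X) (cnj \<alpha>) f) (ns_scale (ns_dual X) (cnj \<beta>) g)"
    have h: "h \<in> dual" by (simp add: h_def dual_add_closed dual_scale_closed f g)
    have inner_eq: "inner w (u, v) = Re (cnj \<alpha> * u + cnj \<beta> * v)" for u v
      by (simp add: \<alpha>\<beta> inner_complex_def)
    have hx: "s < Re (h x)" if "x \<in> ns_ball" for x
    proof -
      have "(f x, g x) \<in> closure S" using that closure_subset[of S] by (auto simp: S_def)
      from w(2)[OF this] show ?thesis
        using that by (simp add: inner_eq h_def dual_add_apply dual_scale_apply ball_subset)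
    qed
    have "dual_norm h \<le> - s"
    proof (rule dual_norm_le)
      fix x assume x: "x \<in> ns_ball"
      \<comment> \<open>The ball is stable under factors of modulus at most 1. Here \<open>c\<close>
        turns \<open>h x\<close> onto the negative real axis, so that the lower bound
        \<open>s\<close> for real parts becomes a bound for the modulus; where
        \<open>h x = 0\<close> the factor 0 serves.\<close>
      define c where "c = (if h x = 0 then 0 else - cnj (h x) / of_real (cmod (h x)))"
      have c: "cmod c \<le> 1" "c * h x = - of_real (cmod (h x))"
        by (auto simp: c_def norm_divide mult.commute[of "cnj (h x)"] complex_norm_square[symmetric] power2_eq_square)
      have "s < Re (h (ns_scale X c x))" using hx scale_in_ball[OF x c(1)] by blast
      then show "cmod (h x) \<le> - s" using x h c by (simp add: dual_scale ball_subset)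
    qed
    moreover have "Re (\<xi> h) < s"
      using w(1) by (simp add: inner_eq h_def add scale f g dual_scale_closed)
    ultimately show False
      using bound[OF h] abs_Re_le_cmod[of "\<xi> h"] by linarith
  qed
  then obtain x where x: "x \<in> ns_ball" "dist (f x, g x) (\<xi> f, \<xi> g) < e"
    using \<open>0 < e\<close> by (force simp: closure_approachable S_def)
  have "dist (f x) (\<xi> f) < e" "dist (g x) (\<xi> g) < e"
    using dist_fst_le[of "(f x, g x)" "(\<xi> f, \<xi> g)"] dist_snd_le[of "(f x, g x)" "(\<xi> f, \<xi> g)"] x(2) by auto
  then show ?thesis using that x(1) by (simp add: dist_norm)
qed

text \<open>The assumptions \<open>bound\<close> and \<open>norming\<close> say that
  \<open>\<xi>\<close> has norm 1. Points of the ball at which a nearly norming functional is close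
  to its value under \<open>\<xi>\<close> form a slice of small diameter by uniform convexity. By
  \<open>Helly_pair\<close> each slice also contains points that approximate \<open>\<xi>\<close> at
  any prescribed second functional, so the point to which the slices shrink represents
  \<open>\<xi>\<close>.\<close>

lemma Milman_Pettis_unit:
  assumes complete: "metric.mcomplete"
    and convex: "\<And>e. 0 < e \<Longrightarrow> \<exists>d>0. \<forall>x\<in>ns_ball. \<forall>y\<in>ns_ball. 2 - d \<le> ns_norm X (ns_add X x y) \<longrightarrow> ns_dist X x y \<le> e"
    and add: "\<And>f g. f \<in> dual \<Longrightarrow> g \<in> dual \<Longrightarrow> \<xi> (ns_add (ns_dual X) f g) = \<xi> f + \<xi> g"
    and scale: "\<And>c f. f \<in> dual \<Longrightarrow> \<xi> (ns_scale (ns_dual X) c f) = c * \<xi> f"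
    and bound: "\<And>f. f \<in> dual \<Longrightarrow> cmod (\<xi> f) \<le> dual_norm f"
    and norming: "\<And>d. 0 < d \<Longrightarrow> \<exists>f\<in>dual. dual_norm f \<le> 1 \<and> 1 - d < Re (\<xi> f)"
  obtains x where "x \<in> ns_carrier X" "\<And>f. f \<in> dual \<Longrightarrow> f x = \<xi> f"
proof -
  define r where "r n = inverse (real (Suc n))" for n
  have r: "0 < r n" for n by (simp add: r_def)
  have r0: "r \<longlonglongrightarrow> 0" unfolding r_def by (rule LIMSEQ_inverse_real_of_nat)
  \<comment> \<open>Two errors of size \<open>d / 4\<close>, one in norming and one in membership of
    the slice \<open>T n\<close>, leave \<open>Re (f n z)\<close> above \<open>1 - d / 2\<close>;
    for the sum of two points this gives the threshold \<open>2 - d\<close>.\<close>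
  have "\<exists>d f. 0 < d \<and> f \<in> dual \<and> dual_norm f \<le> 1 \<and> 1 - d / 4 < Re (\<xi> f) \<and>
      (\<forall>x\<in>ns_ball. \<forall>y\<in>ns_ball. 2 - d \<le> ns_norm X (ns_add X x y) \<longrightarrow> ns_dist X x y \<le> r n)" for n
  proof -
    obtain d where d: "0 < d"
      "\<forall>x\<in>ns_ball. \<forall>y\<in>ns_ball. 2 - d \<le> ns_norm X (ns_add X x y) \<longrightarrow> ns_dist X x y \<le> r n"
      using convex[OF r] by blast
    moreover obtain f where "f \<in> dual" "dual_norm f \<le> 1" "1 - d / 4 < Re (\<xi> f)"
      using norming[of "d / 4"] d(1) by auto
    ultimately show ?thesis by blast
  qed
  then obtain d f where d: "\<And>n. 0 < d n" and f: "\<And>n. f n \<in> dual" "\<And>n. dual_norm (f n) \<le> 1"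
      "\<And>n. 1 - d n / 4 < Re (\<xi> (f n))"
    and diam: "\<And>n x y. x \<in> ns_ball \<Longrightarrow> y \<in> ns_ball \<Longrightarrow> 2 - d n \<le> ns_norm X (ns_add X x y) \<Longrightarrow> ns_dist X x y \<le> r n"
    by metis
  define T where "T n = {x \<in> ns_ball. cmod (f n x - \<xi> (f n)) < d n / 4}" for n
  have T: "ns_dist X x y \<le> r n" if "x \<in> T n" "y \<in> T n" for x y n
  proof (rule diam)
    show xy: "x \<in> ns_ball" "y \<in> ns_ball" using that by (auto simp: T_def)
    have near: "1 - d n / 2 < Re (f n z)" if "z \<in> T n" for z
      using that f(3)[of n] abs_Re_le_cmod[of "f n z - \<xi> (f n)"] unfolding T_def by auto
    then have "2 - d n < Re (f n (ns_add X x y))"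
      using that[THEN near] xy f(1)[of n] by (simp add: dual_add ball_subset)
    also have "\<dots> \<le> dual_norm (f n) * ns_norm X (ns_add X x y)"
      using dual_le_norm[OF f(1)[of n], of "ns_add X x y"] xy complex_Re_le_cmod order_trans
      by (blast intro: add_closed ball_subset)
    also have "\<dots> \<le> ns_norm X (ns_add X x y)"
      using f(2)[of n] xy by (intro mult_left_le_one_le norm_nonneg add_closed ball_subset dual_norm_nonneg f(1))
    finally show "2 - d n \<le> ns_norm X (ns_add X x y)" by simp
  qed
  have meet: "\<exists>x\<in>T n. cmod (g x - \<xi> g) < e" if g: "g \<in> dual" and e: "0 < e" for n g e
  proof -
    obtain x where "x \<in> ns_ball" "cmod (f n x - \<xi> (f n)) < min e (d n / 4)" "cmod (g x - \<xi> g) < min e (d n / 4)"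
      using Helly_pair[OF add scale bound f(1)[of n] g, of "min e (d n / 4)"] e d[of n] by auto
    then show ?thesis by (auto simp: T_def)
  qed
  have "\<exists>x. x \<in> T n" for n using meet[OF f(1) d] by blast
  then obtain x where x: "\<And>n. x n \<in> T n" by metis
  have TX: "z \<in> ns_carrier X" if "z \<in> T n" for z n using that by (simp add: T_def ball_subset)
  \<comment> \<open>The slices need not be nested. Helly's condition for the pair
    \<open>f n\<close>, \<open>f m\<close> yields a common point of \<open>T n\<close> and
    \<open>T m\<close>, through which \<open>x n\<close> and \<open>x m\<close> are
    compared.\<close>
  have xx: "ns_dist X (x n) (x m) \<le> r n + r m" for n m
  proof -
    obtain y where y: "y \<in> T n" "cmod (f m y - \<xi> (f m)) < d m / 4" using meet[OF f(1)[of m], of "d m / 4" n] d[of m] by auto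
    then have y': "y \<in> T m" by (simp add: T_def)
    have "ns_dist X (x n) (x m) \<le> ns_dist X (x n) y + ns_dist X y (x m)"
      by (intro metric.triangle TX[OF x] TX[OF y'])
    then show ?thesis using T[OF x y(1)] T[OF y' x] by simp
  qed
  have "metric.MCauchy x"
    unfolding metric.MCauchy_def
  proof (intro conjI allI impI)
    show "range x \<subseteq> ns_carrier X" using TX[OF x] by blast
    fix e :: real assume "0 < e"
    then have "\<forall>\<^sub>F n in sequentially. r n < e / 2" using order_tendstoD(2)[OF r0, of "e / 2"] by simp
    then obtain N where N: "\<And>n. N \<le> n \<Longrightarrow> r n < e / 2" by (auto simp: eventually_sequentially)
    show "\<exists>N. \<forall>n n'. N \<le> n \<longrightarrow> N \<le> n' \<longrightarrow> ns_dist X (x n) (x n') < e"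
    proof (intro exI allI impI)
      fix n m assume "N \<le> n" "N \<le> m"
      then show "ns_dist X (x n) (x m) < e" using N[of n] N[of m] xx[of n m] by simp
    qed
  qed
  then obtain l where "limitin metric.mtopology x l sequentially"
    using complete metric.mcomplete_def by blast
  then have l: "l \<in> ns_carrier X" and lim: "(\<lambda>n. ns_dist X (x n) l) \<longlonglongrightarrow> 0"
    by (auto simp: metric.limitin_metric_dist_null)
  have "g l = \<xi> g" if g: "g \<in> dual" for g
  proof -
    define K where "K = dual_norm g"
    \<comment> \<open>A point \<open>y\<close> of \<open>T n\<close> that is good for
      \<open>g\<close> lies within \<open>r n\<close> of \<open>x n\<close>, and \<open>x n\<close>
      is close to the limit; \<open>K\<close> is a Lipschitz constant of \<open>g\<close>.\<close>
    have "cmod (g l - \<xi> g) \<le> K * (r n + ns_dist X (x n) l) + r n" for n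
    proof -
      obtain y where y: "y \<in> T n" "cmod (g y - \<xi> g) < r n" using meet[OF g r] by blast
      have "cmod (g l - g y) \<le> K * ns_dist X l y"
        using dual_le_norm[OF g sub_closed[OF l TX[OF y(1)]]] l TX[OF y(1)] g
        by (simp add: K_def dual_sub ns_dist_eq)
      also have "\<dots> \<le> K * (r n + ns_dist X (x n) l)"
      proof (rule mult_left_mono)
        show "ns_dist X l y \<le> r n + ns_dist X (x n) l"
          using metric.triangle[OF l TX[OF x[of n]] TX[OF y(1)]] T[OF x y(1)] metric.commute[of l "x n"] by linarith
      qed (simp add: K_def dual_norm_nonneg g)
      finally show ?thesis
        using y(2) norm_triangle_ineq[of "g l - g y" "g y - \<xi> g"] by simp
    qed
    moreover have "(\<lambda>n. K * (r n + ns_dist X (x n) l) + r n) \<longlonglongrightarrow> K * (0 + 0) + 0"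
      by (intro tendsto_intros r0 lim)
    ultimately have "cmod (g l - \<xi> g) \<le> K * (0 + 0) + 0"
      by (intro LIMSEQ_le_const) auto
    then show ?thesis by simp
  qed
  then show ?thesis using that l by blast
qed

text \<open>Evaluation at a point is bounded, which settles one inclusion. For the other, a nonzero
  \<open>\<xi>\<close> is divided by its norm to reach the unit case, and the representing point is
  scaled back afterwards.\<close>

theorem Milman_Pettis:
  assumes complete: "metric.mcomplete"
    and convex: "\<And>e. 0 < e \<Longrightarrow> \<exists>d>0. \<forall>x\<in>ns_ball. \<forall>y\<in>ns_ball. 2 - d \<le> ns_norm X (ns_add X x y) \<longrightarrow> ns_dist X x y \<le> e"
  shows "ns_reflexive X"
  unfolding ns_reflexive_def
proof (intro equalityI subsetI)
  fix \<xi> assume "\<xi> \<in> ns_canonical_embedding X ` ns_carrier X"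
  then obtain x where x: "x \<in> ns_carrier X" "\<xi> = (\<lambda>f\<in>dual. f x)"
    by (auto simp: ns_canonical_embedding_def)
  have "cmod (f x) \<le> ns_norm X x * dual_norm f" if "f \<in> dual" for f
    using dual_le_norm[OF that x(1)] by (simp add: mult.commute)
  then show "\<xi> \<in> ns_carrier (ns_dual (ns_dual X))"
    unfolding ns_dual_def[of "ns_dual X"]
    using x by (auto simp: dual_add_closed dual_scale_closed dual_add_apply dual_scale_apply)
next
  fix \<xi> assume "\<xi> \<in> ns_carrier (ns_dual (ns_dual X))"
  then have ext: "\<xi> \<in> extensional dual"
    and add: "\<And>f g. f \<in> dual \<Longrightarrow> g \<in> dual \<Longrightarrow> \<xi> (ns_add (ns_dual X) f g) = \<xi> f + \<xi> g"
    and scale: "\<And>c f. f \<in> dual \<Longrightarrow> \<xi> (ns_scale (ns_dual X) c f) = c * \<xi> f"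
    and "\<exists>B. \<forall>f\<in>dual. cmod (\<xi> f) \<le> B * dual_norm f"
    unfolding ns_dual_def[of "ns_dual X"] by auto
  then obtain B where B: "\<And>f. f \<in> dual \<Longrightarrow> cmod (\<xi> f) \<le> B * dual_norm f" by blast
  define D where "D = {f \<in> dual. dual_norm f \<le> 1}"
  \<comment> \<open>The norm of \<open>\<xi>\<close> in the bidual.\<close>
  define N where "N = (SUP f\<in>D. cmod (\<xi> f))"
  have "cmod (\<xi> f) \<le> \<bar>B\<bar>" if "f \<in> D" for f
  proof -
    have "B * dual_norm f \<le> \<bar>B\<bar> * 1"
      using that by (intro mult_mono) (auto simp: D_def dual_norm_nonneg)
    then show ?thesis using B[of f] that by (simp add: D_def)
  qed
  then have bdd: "bdd_above ((\<lambda>f. cmod (\<xi> f)) ` D)" by (auto simp: bdd_above_def)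
  have N_upper: "cmod (\<xi> f) \<le> N * dual_norm f" if f: "f \<in> dual" for f
  proof (cases "dual_norm f = 0")
    case True
    then show ?thesis using B[OF f] by simp
  next
    case False
    then have pos: "0 < dual_norm f" using dual_norm_nonneg[OF f] by simp
    let ?c = "of_real (1 / dual_norm f) :: complex"
    have c: "cmod ?c = 1 / dual_norm f" using pos by (simp only: norm_of_real) simp
    have "ns_scale (ns_dual X) ?c f \<in> D"
      using dual_norm_scale_le[OF f, of ?c] pos
      by (simp add: D_def dual_scale_closed f c del: of_real_divide)
    then have "cmod (\<xi> (ns_scale (ns_dual X) ?c f)) \<le> N"
      unfolding N_def by (intro cSUP_upper bdd)
    then show ?thesis using pos by (simp add: scale f norm_mult c field_simps del: of_real_divide)
  qed
  have "\<exists>x\<in>ns_carrier X. \<forall>f\<in>dual. f x = \<xi> f"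
  proof (cases "N \<le> 0")
    case True
    have "\<xi> f = 0" if "f \<in> dual" for f
    proof -
      have "N * dual_norm f \<le> 0" using True dual_norm_nonneg[OF that] by (simp add: mult_nonpos_nonneg)
      then have "cmod (\<xi> f) \<le> 0" using N_upper[OF that] by linarith
      then show ?thesis by simp
    qed
    then show ?thesis using zero_closed dual_zero by auto
  next
    case False
    then have N: "0 < N" by simp
    define \<eta> where "\<eta> f = \<xi> f / of_real N" for f
    have "\<exists>f\<in>dual. dual_norm f \<le> 1 \<and> 1 - d < Re (\<eta> f)" if "0 < d" for d
    proof -
      have "N * (1 - d) < N" using N that by simp
      \<comment> \<open>A witness that \<open>D\<close> is nonempty, as comparison with the supremum
        requires. Scaling by 0 makes the norm bound an instance of
        \<open>dual_norm_scale_le\<close>.\<close>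
      moreover have "ns_scale (ns_dual X) 0 (\<lambda>x\<in>ns_carrier X. 0) \<in> D"
      proof -
        have z: "(\<lambda>x\<in>ns_carrier X. 0) \<in> dual"
          by (auto simp: ns_dual_def add_closed scale_closed intro!: exI[of _ 0])
        then show ?thesis
          using dual_norm_scale_le[OF z, of 0] by (simp add: D_def dual_scale_closed)
      qed
      ultimately obtain f where f: "f \<in> D" "N * (1 - d) < cmod (\<xi> f)"
        unfolding N_def using less_cSUP_iff[OF _ bdd] by blast
      \<comment> \<open>A unimodular factor that turns the value of \<open>\<xi>\<close> onto the
        nonnegative real axis, because the unit case asks for a large real part.\<close>
      define c where "c = (if \<xi> f = 0 then 1 else cnj (\<xi> f) / of_real (cmod (\<xi> f)))"
      have c: "cmod c = 1" "c * \<xi> f = of_real (cmod (\<xi> f))"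
        by (auto simp: c_def norm_divide mult.commute[of "cnj (\<xi> f)"] complex_norm_square[symmetric] power2_eq_square)
      have fd: "f \<in> dual" "dual_norm f \<le> 1" using f by (auto simp: D_def)
      show ?thesis
      proof (intro bexI conjI)
        show "ns_scale (ns_dual X) c f \<in> dual" using fd by (simp add: dual_scale_closed)
        show "dual_norm (ns_scale (ns_dual X) c f) \<le> 1" using dual_norm_scale_le[OF fd(1), of c] fd c by simp
        have "\<eta> (ns_scale (ns_dual X) c f) = of_real (cmod (\<xi> f) / N)"
          using fd c by (simp add: \<eta>_def scale)
        then have "Re (\<eta> (ns_scale (ns_dual X) c f)) = cmod (\<xi> f) / N" by (simp del: of_real_divide)
        then show "1 - d < Re (\<eta> (ns_scale (ns_dual X) c f))"
          using f(2) N by (simp add: less_divide_eq mult.commute)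
      qed
    qed
    moreover have "cmod (\<eta> f) \<le> dual_norm f" if "f \<in> dual" for f
      using N_upper[OF that] N by (simp add: \<eta>_def norm_divide field_simps)
    ultimately obtain x where x: "x \<in> ns_carrier X" "\<And>f. f \<in> dual \<Longrightarrow> f x = \<eta> f"
      using Milman_Pettis_unit[OF complete convex, of \<eta>] add scale N
      by (auto simp: \<eta>_def add_divide_distrib)
    have "f (ns_scale X (of_real N) x) = \<xi> f" if "f \<in> dual" for f
      using x(1) x(2)[OF that] that N by (simp add: dual_scale \<eta>_def)
    then show ?thesis using scale_closed[OF x(1)] by blast
  qed
  then obtain x where x: "x \<in> ns_carrier X" "\<And>f. f \<in> dual \<Longrightarrow> f x = \<xi> f" by blast
  have "\<xi> = ns_canonical_embedding X x"
    unfolding ns_canonical_embedding_def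
    by (rule extensionalityI[OF ext]) (auto simp: x)
  then show "\<xi> \<in> ns_canonical_embedding X ` ns_carrier X" using x(1) by blast
qed

end

section \<open>The spaces \<open>L\<^sub>p\<close>\<close>

lemma powr_convex_nonneg:
  assumes "1 \<le> q" "0 \<le> s" "0 \<le> t" "0 \<le> u" "0 \<le> v" "u + v = (1::real)"
  shows "(u * s + v * t) powr q \<le> u * s powr q + v * t powr q"
proof -
  \<comment> \<open>If \<open>s\<close> or \<open>t\<close> vanishes, convexity reduces to u^q \<le>
    u on the unit interval; convexity on the open half-line covers the rest.\<close>
  have *: "(u * s) powr q \<le> u * s powr q" if "0 \<le> u" "u \<le> 1" for u s :: real
  proof (cases "u = 0")
    case False
    then have "u powr q \<le> u powr 1" using that assms(1) by (intro powr_mono') auto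
    then show ?thesis using that by (simp add: powr_mult mult_right_mono)
  qed simp
  consider "s = 0" | "t = 0" | "0 < s" "0 < t" using assms by fastforce
  then show ?thesis
  proof cases
    case 3
    have "(u *\<^sub>R s + v *\<^sub>R t) powr q \<le> u * s powr q + v * t powr q"
      using powr_convex[OF assms(1)] 3 assms unfolding convex_on_def by blast
    then show ?thesis by simp
  qed (use *[of v t] *[of u s] assms in auto)
qed

text \<open>The mean value theorem on the two halves of the interval compares the increments, since
  the derivative of the power is strictly increasing. The left end may be 0, so the derivative is
  taken at interior points only.\<close>

lemma powr_midpoint_strict:
  assumes q: "1 < q" and x: "0 \<le> x" and xy: "x < (y::real)"
  shows "((x + y) / 2) powr q < (x powr q + y powr q) / 2"
proof -
  have mvt: "\<exists>c. a < c \<and> c < b \<and> b powr q - a powr q = (b - a) * (q * c powr (q - 1))"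
    if "0 \<le> a" "a < b" for a b
  proof -
    have "\<exists>l c. a < c \<and> c < b \<and> DERIV (\<lambda>x. x powr q) c :> l \<and> b powr q - a powr q = (b - a) * l"
    proof (rule MVT)
      show "continuous_on {a..b} (\<lambda>x. x powr q)"
        using that q by (intro continuous_on_powr' continuous_intros) auto
      fix x assume "a < x" "x < b"
      then show "(\<lambda>x. x powr q) differentiable (at x)"
        using that has_real_derivative_powr[of x q] real_differentiable_def by fastforce
    qed fact
    then obtain l c where c: "a < c" "c < b" "DERIV (\<lambda>x. x powr q) c :> l" "b powr q - a powr q = (b - a) * l"
      by blast
    moreover have "l = q * c powr (q - 1)"
      using DERIV_unique[OF c(3)] has_real_derivative_powr[of c q] that c by simp
    ultimately show ?thesis by blast
  qed
  define m where "m = (x + y) / 2"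
  obtain c where c: "x < c" "c < m" "m powr q - x powr q = (m - x) * (q * c powr (q - 1))"
    using mvt[of x m] x xy by (auto simp: m_def)
  obtain d where d: "m < d" "d < y" "y powr q - m powr q = (y - m) * (q * d powr (q - 1))"
    using mvt[of m y] x xy by (auto simp: m_def)
  have "c powr (q - 1) < d powr (q - 1)"
    using c d x q by (intro powr_less_mono2) auto
  then have "(m - x) * (q * c powr (q - 1)) < (m - x) * (q * d powr (q - 1))"
    using q c by (intro mult_strict_left_mono) auto
  moreover have "m - x = y - m" by (simp add: m_def field_simps)
  ultimately have "m powr q - x powr q < y powr q - m powr q" by (simp only: c(3) d(3))
  then have "m powr q < (x powr q + y powr q) / 2" by argo
  then show ?thesis by (simp add: m_def)
qed

text \<open>The gap in the midpoint convexity inequality of the q-th power of the norm. Its integral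
  is small when two functions of the unit ball have a midpoint of norm close to 1.\<close>

definition convexity_defect :: "real \<Rightarrow> 'b::real_normed_vector \<Rightarrow> 'b \<Rightarrow> real" where
  "convexity_defect q a b = (norm a powr q + norm b powr q) / 2 - (norm (a + b) / 2) powr q"

lemma convexity_defect_nonneg:
  assumes "1 \<le> q"
  shows "0 \<le> convexity_defect q a b"
proof -
  have "(norm (a + b) / 2) powr q \<le> (1 / 2 * norm a + 1 / 2 * norm b) powr q"
    using assms norm_triangle_ineq[of a b] by (intro powr_mono2) auto
  also have "\<dots> \<le> 1 / 2 * norm a powr q + 1 / 2 * norm b powr q"
    using assms by (intro powr_convex_nonneg) auto
  finally show ?thesis by (simp add: convexity_defect_def field_simps)
qed

text \<open>Strict convexity of the power forces equal norms. What remains is equality in the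
  triangle inequality, which in an inner product space makes the vectors parallel.\<close>

lemma convexity_defect_eq_0_imp:
  fixes a b :: "'b::real_inner"
  assumes q: "1 < q" and 0: "convexity_defect q a b = 0"
  shows "a = b"
proof -
  have le: "(norm (a + b) / 2) powr q \<le> ((norm a + norm b) / 2) powr q"
    using q norm_triangle_ineq[of a b] by (intro powr_mono2) auto
  have eq: "norm a = norm b"
  proof (rule ccontr)
    assume "norm a \<noteq> norm b"
    then have "((norm a + norm b) / 2) powr q < (norm a powr q + norm b powr q) / 2"
      using powr_midpoint_strict[OF q, of "norm a" "norm b"] powr_midpoint_strict[OF q, of "norm b" "norm a"]
      by (auto simp: linorder_neq_iff add.commute)
    then show False using le 0 by (simp add: convexity_defect_def)
  qed
  then have "(norm (a + b) / 2) powr q = norm a powr q" using 0 by (simp add: convexity_defect_def)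
  then have "norm (a + b) / 2 = norm a"
    using powr_less_mono2[of q "norm (a + b) / 2" "norm a"] powr_less_mono2[of q "norm a" "norm (a + b) / 2"] q
    by (cases "norm (a + b) / 2" "norm a" rule: linorder_cases) auto
  then have "norm (a + b) = norm a + norm b" using eq by simp
  then have "norm a *\<^sub>R b = norm b *\<^sub>R a" by (simp only: norm_triangle_eq)
  then show ?thesis using eq by (cases "norm b = 0") auto
qed

text \<open>Both sides are homogeneous of degree \<open>q\<close>, so it suffices to consider the compact set of
  pairs with \<open>norm a powr q + norm b powr q = 1\<close>. Unlike Clarkson's inequalities, this form needs
  no distinction between \<open>q \<le> 2\<close> and \<open>q \<ge> 2\<close>.\<close>

lemma norm_diff_powr_le_defect:
  assumes q: "1 < q" and e: "0 < e"
  obtains C where "0 \<le> C"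
    "\<And>a b :: 'b::euclidean_space. norm (a - b) powr q \<le> e * (norm a powr q + norm b powr q) + C * convexity_defect q a b"
proof -
  \<comment> \<open>On this compact set the two vectors stay apart, so the defect is positive and
    attains a positive minimum \<open>m\<close>.\<close>
  define K where "K = {p :: 'b \<times> 'b. norm (fst p) powr q + norm (snd p) powr q = 1 \<and> e \<le> norm (fst p - snd p) powr q}"
  have cont: "continuous_on UNIV (\<lambda>p. norm (h p) powr q)" if "continuous_on UNIV h" for h :: "'b \<times> 'b \<Rightarrow> 'b"
    using q that by (intro continuous_on_powr' continuous_intros) auto
  note [continuous_intros] = cont
  have le1: "norm a \<le> 1" if "norm a powr q + norm b powr q = 1" for a b :: 'b
  proof (rule ccontr)
    assume "\<not> norm a \<le> 1"
    then have "1 powr q < norm a powr q" using q by (intro powr_less_mono2) auto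
    then show False using that powr_ge_zero[of "norm b" q] by simp
  qed
  have "K \<subseteq> cball 0 1 \<times> cball 0 1"
    using le1 by (auto simp: K_def) (metis add.commute le1)
  then have "bounded K" using bounded_Times bounded_cball bounded_subset by blast
  moreover have "closed K"
    unfolding K_def by (intro closed_Collect_conj closed_Collect_eq closed_Collect_le continuous_intros)
  ultimately have "compact K" by (simp add: compact_eq_bounded_closed)
  have "\<exists>m>0. \<forall>p\<in>K. m \<le> convexity_defect q (fst p) (snd p)"
  proof (cases "K = {}")
    case False
    have "continuous_on K (\<lambda>p. convexity_defect q (fst p) (snd p))"
    proof (rule continuous_on_subset)
      have "continuous_on UNIV (\<lambda>p::'b \<times> 'b. norm ((1 / 2) *\<^sub>R (fst p + snd p)) powr q)"
        by (intro continuous_intros)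
      then have "continuous_on UNIV (\<lambda>p::'b \<times> 'b. (norm (fst p + snd p) / 2) powr q)"
        by simp
      then show "continuous_on UNIV (\<lambda>p::'b \<times> 'b. convexity_defect q (fst p) (snd p))"
        unfolding convexity_defect_def
        by (intro continuous_on_diff continuous_on_divide continuous_on_add cont[of fst] cont[of snd]
            continuous_on_const) (auto intro: continuous_intros)
    qed simp
    from continuous_attains_inf[OF \<open>compact K\<close> False this]
    obtain p where p: "p \<in> K" "\<And>p'. p' \<in> K \<Longrightarrow> convexity_defect q (fst p) (snd p) \<le> convexity_defect q (fst p') (snd p')"
      by blast
    have "fst p \<noteq> snd p" using p(1) e by (auto simp: K_def)
    then have "convexity_defect q (fst p) (snd p) \<noteq> 0"
      using convexity_defect_eq_0_imp[OF q] by blast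
    then have "0 < convexity_defect q (fst p) (snd p)"
      using convexity_defect_nonneg[of q "fst p" "snd p"] q by linarith
    then show ?thesis using p by blast
  qed (auto intro: exI[of _ 1])
  then obtain m where m: "0 < m" "\<And>p. p \<in> K \<Longrightarrow> m \<le> convexity_defect q (fst p) (snd p)" by blast
  \<comment> \<open>Chosen so that \<open>C * m\<close> is 2^q, an upper bound for the left-hand
    side once both norms are at most 1.\<close>
  define C where "C = 2 powr q / m"
  have C: "0 \<le> C" using m by (simp add: C_def)
  have normalized: "norm (a - b) powr q \<le> e + C * convexity_defect q a b"
    if ab: "norm a powr q + norm b powr q = 1" for a b :: 'b
  proof (cases "e \<le> norm (a - b) powr q")
    case True
    then have "(a, b) \<in> K" using ab by (simp add: K_def)
    have "norm (a - b) \<le> 2"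
      using norm_triangle_ineq4[of a b] le1[OF ab] le1[of b a] ab by simp
    then have "norm (a - b) powr q \<le> C * m"
      using m q by (simp add: C_def powr_mono2)
    also have "\<dots> \<le> C * convexity_defect q a b"
      using m(2)[OF \<open>(a, b) \<in> K\<close>] C by (simp add: mult_left_mono)
    finally show ?thesis using e by simp
  next
    case False
    then show ?thesis using C convexity_defect_nonneg[of q a b] q by (smt (verit) mult_nonneg_nonneg)
  qed
  have "norm (a - b) powr q \<le> e * (norm a powr q + norm b powr q) + C * convexity_defect q a b" for a b :: 'b
  proof (cases "norm a powr q + norm b powr q = 0")
    case True
    then have "norm a powr q = 0" "norm b powr q = 0"
      using powr_ge_zero[of "norm a" q] powr_ge_zero[of "norm b" q] by linarith+
    then show ?thesis by (simp add: convexity_defect_def)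
  next
    case False
    define s where "s = norm a powr q + norm b powr q"
    have s: "0 < s" unfolding s_def using False powr_ge_zero[of "norm a" q] powr_ge_zero[of "norm b" q] by linarith
    \<comment> \<open>The factor that brings the sum of the q-th powers to 1.\<close>
    define t where "t = 1 / s powr (1 / q)"
    have t: "0 < t" "t powr q = 1 / s" using s q by (auto simp: t_def powr_divide powr_powr)
    have n: "norm (t *\<^sub>R c) powr q = norm c powr q / s" for c :: 'b
      using t by (simp add: powr_mult)
    have n': "norm (t *\<^sub>R a + t *\<^sub>R b) / 2 = t * (norm (a + b) / 2)"
      using t by (simp add: scaleR_add_right[symmetric])
    have "convexity_defect q (t *\<^sub>R a) (t *\<^sub>R b) = convexity_defect q a b / s"
      unfolding convexity_defect_def n n' powr_mult[of t] t(2) using s by (simp add: field_simps)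
    moreover have "norm (t *\<^sub>R a - t *\<^sub>R b) powr q = norm (a - b) powr q / s"
      using n[of "a - b"] by (simp add: scaleR_diff_right)
    moreover have "norm (t *\<^sub>R a) powr q + norm (t *\<^sub>R b) powr q = 1"
      unfolding n using s by (simp add: s_def add_divide_distrib[symmetric])
    ultimately have "norm (a - b) powr q / s \<le> e + C * (convexity_defect q a b / s)"
      using normalized by metis
    then show ?thesis using s by (simp add: s_def[symmetric] field_simps)
  qed
  then show ?thesis using that C by blast
qed

section \<open>Norm estimates, the Minkowski inequality and the embedding into L_1\<close>

lemma Lp_fun_measurable: "f \<in> Lp_fun p M \<Longrightarrow> f \<in> borel_measurable M"
  by (simp add: Lp_fun_def)

lemma Lp_norm_nonneg: "0 \<le> Lp_norm p M f"
  by (simp add: Lp_norm_def)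

lemma Lp_fun_infinityI:
  assumes "f \<in> borel_measurable M" "0 \<le> c" "AE x in M. norm (f x) \<le> c"
  shows "f \<in> Lp_fun \<infinity> M" "Lp_norm \<infinity> M f \<le> c"
proof -
  have "esssup M (\<lambda>x. ennreal (norm (f x))) \<le> ennreal c"
    using assms by (intro esssup_I) (auto intro: ennreal_leI)
  then show "f \<in> Lp_fun \<infinity> M" "Lp_norm \<infinity> M f \<le> c"
    using assms by (auto simp: Lp_fun_def Lp_norm_def less_top enn2real_leI intro: le_less_trans)
qed

lemma Lp_norm_infinity_AE:
  assumes "f \<in> Lp_fun \<infinity> M"
  shows "AE x in M. norm (f x) \<le> Lp_norm \<infinity> M f"
proof -
  have fin: "esssup M (\<lambda>x. ennreal (norm (f x))) < \<infinity>" using assms by (simp add: Lp_fun_def)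
  show ?thesis
    using esssup_AE[of "\<lambda>x. ennreal (norm (f x))" M]
  proof eventually_elim
    case (elim x)
    \<comment> \<open>Finiteness of the essential supremum matters: \<open>enn2real\<close> sends
      infinity to 0.\<close>
    then show ?case
      using fin by (simp add: Lp_norm_def) (metis enn2real_ennreal enn2real_mono infinity_ennreal_def norm_ge_zero)
  qed
qed

lemma exponent_cases:
  assumes "1 < (p::ennreal)"
  obtains "p = \<infinity>" | "p \<noteq> \<infinity>" "1 < enn2real p"
proof (cases p rule: ennreal_cases)
  case (real r)
  then show ?thesis using assms that by (simp add: ennreal_less_iff flip: ennreal_1)
qed (use that in simp)

lemma Lp_fun_finite_iff:
  "p \<noteq> \<infinity> \<Longrightarrow> f \<in> Lp_fun p M \<longleftrightarrow> f \<in> borel_measurable M \<and> integrable M (\<lambda>x. norm (f x) powr enn2real p)"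
  by (simp add: Lp_fun_def)

lemma Lp_norm_powr:
  assumes "p \<noteq> \<infinity>" "1 < enn2real p"
  shows "Lp_norm p M f powr enn2real p = (LINT x|M. norm (f x) powr enn2real p)"
  using assms by (simp add: Lp_norm_def powr_powr)

lemma Lp_norm_le_iff:
  assumes "p \<noteq> \<infinity>" "1 < enn2real p" "0 \<le> c"
  shows "Lp_norm p M f \<le> c \<longleftrightarrow> (LINT x|M. norm (f x) powr enn2real p) \<le> c powr enn2real p"
  unfolding Lp_norm_powr[OF assms(1,2), symmetric]
  using assms powr_mono2[of "enn2real p" "Lp_norm p M f" c] powr_less_mono2[of "enn2real p" c "Lp_norm p M f"]
  by (auto simp: Lp_norm_nonneg not_le[symmetric])

text \<open>The bound is on the nonnegative integral, so that it yields integrability and the norm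
  estimate at once.\<close>

lemma Lp_fun_finiteI:
  assumes p: "p \<noteq> \<infinity>" "1 < enn2real p" and c: "0 \<le> c" and f: "f \<in> borel_measurable M"
    and le: "(\<integral>\<^sup>+x. ennreal (norm (f x) powr enn2real p) \<partial>M) \<le> ennreal (c powr enn2real p)"
  shows "f \<in> Lp_fun p M" "Lp_norm p M f \<le> c"
proof -
  have [measurable]: "f \<in> borel_measurable M" by fact
  have int: "integrable M (\<lambda>x. norm (f x) powr enn2real p)"
    using le by (intro integrableI_bounded) (auto intro: le_less_trans)
  then show "f \<in> Lp_fun p M" using f p by (simp add: Lp_fun_finite_iff)
  show "Lp_norm p M f \<le> c"
    using le c by (simp add: Lp_norm_le_iff[OF p] nn_integral_eq_integral[OF int])
qed

text \<open>The types of \<open>f\<close> and \<open>g\<close> may differ, so membership and norms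
  also pass between a bicomplex function and its two complex components.\<close>

lemma Lp_fun_dominated:
  fixes f :: "'a \<Rightarrow> 'b::real_normed_vector" and g :: "'a \<Rightarrow> 'c::real_normed_vector"
  assumes p: "1 < p" and g: "g \<in> Lp_fun p M" and f: "f \<in> borel_measurable M"
    and c: "0 \<le> c" and le: "AE x in M. norm (f x) \<le> c * norm (g x)"
  shows "f \<in> Lp_fun p M" "Lp_norm p M f \<le> c * Lp_norm p M g"
proof -
  have [measurable]: "f \<in> borel_measurable M" "g \<in> borel_measurable M"
    using f Lp_fun_measurable[OF g] by auto
  have "f \<in> Lp_fun p M \<and> Lp_norm p M f \<le> c * Lp_norm p M g"
    using p
  proof (cases rule: exponent_cases)
    case 1
    have "AE x in M. norm (f x) \<le> c * Lp_norm p M g"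
      using le Lp_norm_infinity_AE[OF g[unfolded 1]] unfolding 1
    proof eventually_elim
      case (elim x)
      then show ?case using mult_left_mono[OF elim(2) c] by linarith
    qed
    then show ?thesis unfolding 1
      using Lp_fun_infinityI[OF f, of "c * Lp_norm \<infinity> M g"] c by (simp add: Lp_norm_nonneg)
  next
    case 2
    let ?q = "enn2real p"
    have int: "integrable M (\<lambda>x. norm (g x) powr ?q)" using g 2 by (simp add: Lp_fun_finite_iff)
    have "(\<integral>\<^sup>+x. ennreal (norm (f x) powr ?q) \<partial>M) \<le> (\<integral>\<^sup>+x. ennreal (c powr ?q * norm (g x) powr ?q) \<partial>M)"
    proof (rule nn_integral_mono_AE)
      show "AE x in M. ennreal (norm (f x) powr ?q) \<le> ennreal (c powr ?q * norm (g x) powr ?q)"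
        using le
      proof eventually_elim
        case (elim x)
        then have "norm (f x) powr ?q \<le> (c * norm (g x)) powr ?q" using 2 by (intro powr_mono2) auto
        then show ?case by (simp add: powr_mult ennreal_leI)
      qed
    qed
    also have "\<dots> = ennreal (c powr ?q * (LINT x|M. norm (g x) powr ?q))"
      using int by (subst nn_integral_eq_integral) auto
    also have "\<dots> = ennreal ((c * Lp_norm p M g) powr ?q)"
      by (simp add: powr_mult Lp_norm_powr[OF 2])
    finally show ?thesis
      using Lp_fun_finiteI[OF 2 _ f, of "c * Lp_norm p M g"] c by (simp add: Lp_norm_nonneg)
  qed
  then show "f \<in> Lp_fun p M" "Lp_norm p M f \<le> c * Lp_norm p M g" by auto
qed

lemma Lp_norm_cong_norm:
  fixes f :: "'a \<Rightarrow> 'b::real_normed_vector" and g :: "'a \<Rightarrow> 'c::real_normed_vector"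
  assumes "\<And>x. norm (f x) = norm (g x)"
  shows "Lp_norm p M f = Lp_norm p M g"
  by (simp add: Lp_norm_def assms)

lemma Lp_zero:
  assumes "1 < p"
  shows "(\<lambda>x. 0::'b::real_normed_vector) \<in> Lp_fun p M" "Lp_norm p M (\<lambda>x. 0::'b) = 0"
proof -
  have "(\<lambda>x. 0::'b) \<in> Lp_fun p M \<and> Lp_norm p M (\<lambda>x. 0::'b) \<le> 0"
    using assms
  proof (cases rule: exponent_cases)
    case 1
    show ?thesis unfolding 1 using Lp_fun_infinityI[of "\<lambda>x. 0::'b" M 0] by simp
  next
    case 2
    show ?thesis using Lp_fun_finiteI[OF 2, of 0 "\<lambda>x. 0::'b" M] by simp
  qed
  then show "(\<lambda>x. 0::'b) \<in> Lp_fun p M" "Lp_norm p M (\<lambda>x. 0::'b) = 0"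
    using Lp_norm_nonneg[of p M "\<lambda>x. 0::'b"] by auto
qed

text \<open>For finite \<open>p\<close>, the sum is (\<alpha> + \<beta>) times a convex combination
  of f/\<alpha> and g/\<beta>, where \<alpha> and \<beta> are slightly larger than the two norms.
  Convexity of the power bounds the integral for that combination by 1.\<close>

theorem Lp_Minkowski:
  fixes f g :: "'a \<Rightarrow> 'b::euclidean_space"
  assumes p: "1 < p" and f: "f \<in> Lp_fun p M" and g: "g \<in> Lp_fun p M"
  shows "(\<lambda>x. f x + g x) \<in> Lp_fun p M" "Lp_norm p M (\<lambda>x. f x + g x) \<le> Lp_norm p M f + Lp_norm p M g"
proof -
  have [measurable]: "f \<in> borel_measurable M" "g \<in> borel_measurable M"
    using Lp_fun_measurable f g by auto
  have *: "(\<lambda>x. f x + g x) \<in> Lp_fun p M \<and> Lp_norm p M (\<lambda>x. f x + g x) \<le> (Lp_norm p M f + e) + (Lp_norm p M g + e)"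
    if "0 < e" for e
    using p
  proof (cases rule: exponent_cases)
    case 1
    have "AE x in M. norm (f x + g x) \<le> (Lp_norm p M f + e) + (Lp_norm p M g + e)"
      using Lp_norm_infinity_AE[OF f[unfolded 1]] Lp_norm_infinity_AE[OF g[unfolded 1]] unfolding 1
    proof eventually_elim
      case (elim x)
      then show ?case using norm_triangle_ineq[of "f x" "g x"] that by linarith
    qed
    then show ?thesis
      using Lp_fun_infinityI[of "\<lambda>x. f x + g x" M "(Lp_norm p M f + e) + (Lp_norm p M g + e)"] that
      unfolding 1 by (simp add: Lp_norm_nonneg)
  next
    case 2
    let ?q = "enn2real p"
    \<comment> \<open>The summand \<open>e\<close> makes both divisors positive even when a norm is
      0; it is removed by \<open>field_le_epsilon\<close>.\<close>
    define \<alpha> where "\<alpha> = Lp_norm p M f + e"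
    define \<beta> where "\<beta> = Lp_norm p M g + e"
    have pos: "0 < \<alpha>" "0 < \<beta>" using that Lp_norm_nonneg[of p M f] Lp_norm_nonneg[of p M g] by (auto simp: \<alpha>_def \<beta>_def)
    define u where "u = \<alpha> / (\<alpha> + \<beta>)"
    define v where "v = \<beta> / (\<alpha> + \<beta>)"
    have uv: "0 \<le> u" "0 \<le> v" "u + v = 1" using pos by (auto simp: u_def v_def add_divide_distrib[symmetric])
    let ?c = "(\<alpha> + \<beta>) powr ?q"
    have intf: "integrable M (\<lambda>x. norm (f x) powr ?q)" and intg: "integrable M (\<lambda>x. norm (g x) powr ?q)"
      using f g 2 by (auto simp: Lp_fun_finite_iff)
    have pt: "norm (f x + g x) powr ?q
        \<le> ?c * (u / \<alpha> powr ?q * norm (f x) powr ?q + v / \<beta> powr ?q * norm (g x) powr ?q)" for x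
    proof -
      have "norm (f x + g x) powr ?q \<le> ((\<alpha> + \<beta>) * (u * (norm (f x) / \<alpha>) + v * (norm (g x) / \<beta>))) powr ?q"
      proof (rule powr_mono2)
        have "(\<alpha> + \<beta>) * u = \<alpha>" "(\<alpha> + \<beta>) * v = \<beta>"
          using pos by (auto simp: u_def v_def)
        then have "(\<alpha> + \<beta>) * (u * (norm (f x) / \<alpha>) + v * (norm (g x) / \<beta>)) = norm (f x) + norm (g x)"
          using pos by (simp only: distrib_left mult.assoc[symmetric]) simp
        then show "norm (f x + g x) \<le> (\<alpha> + \<beta>) * (u * (norm (f x) / \<alpha>) + v * (norm (g x) / \<beta>))"
          by (simp add: norm_triangle_ineq)
      qed (use 2 in auto)
      also have "\<dots> \<le> ?c * (u * (norm (f x) / \<alpha>) powr ?q + v * (norm (g x) / \<beta>) powr ?q)"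
        unfolding powr_mult using 2 uv pos by (intro mult_left_mono powr_convex_nonneg) auto
      finally show ?thesis using pos by (simp add: powr_divide)
    qed
    have "(\<integral>\<^sup>+x. ennreal (norm (f x + g x) powr ?q) \<partial>M)
        \<le> (\<integral>\<^sup>+x. ennreal (?c * (u / \<alpha> powr ?q * norm (f x) powr ?q + v / \<beta> powr ?q * norm (g x) powr ?q)) \<partial>M)"
      using pt by (intro nn_integral_mono ennreal_leI)
    also have "\<dots> = ennreal (?c * (u / \<alpha> powr ?q * (LINT x|M. norm (f x) powr ?q) + v / \<beta> powr ?q * (LINT x|M. norm (g x) powr ?q)))"
      using intf intg uv by (subst nn_integral_eq_integral) (auto intro!: mult_nonneg_nonneg add_nonneg_nonneg)
    also have "\<dots> \<le> ennreal (?c * (u + v))"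
    proof (intro ennreal_leI mult_left_mono add_mono)
      have "(LINT x|M. norm (f x) powr ?q) \<le> \<alpha> powr ?q"
        using Lp_norm_le_iff[OF 2, of \<alpha> M f] pos that by (simp add: \<alpha>_def)
      then show "u / \<alpha> powr ?q * (LINT x|M. norm (f x) powr ?q) \<le> u"
        using uv pos by (simp add: field_simps mult_left_mono)
      have "(LINT x|M. norm (g x) powr ?q) \<le> \<beta> powr ?q"
        using Lp_norm_le_iff[OF 2, of \<beta> M g] pos that by (simp add: \<beta>_def)
      then show "v / \<beta> powr ?q * (LINT x|M. norm (g x) powr ?q) \<le> v"
        using uv pos by (simp add: field_simps mult_left_mono)
    qed auto
    finally have "(\<integral>\<^sup>+x. ennreal (norm (f x + g x) powr ?q) \<partial>M) \<le> ennreal ?c" by (simp add: uv)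
    then show ?thesis
      using Lp_fun_finiteI[OF 2, of "\<alpha> + \<beta>" "\<lambda>x. f x + g x" M] pos by (simp add: \<alpha>_def \<beta>_def)
  qed
  then show "(\<lambda>x. f x + g x) \<in> Lp_fun p M" using zero_less_one by blast
  show "Lp_norm p M (\<lambda>x. f x + g x) \<le> Lp_norm p M f + Lp_norm p M g"
  proof (rule field_le_epsilon)
    fix e :: real assume "0 < e"
    then show "Lp_norm p M (\<lambda>x. f x + g x) \<le> Lp_norm p M f + Lp_norm p M g + e"
      using *[of "e / 2"] by simp
  qed
qed

lemma Lp_diff:
  fixes f g :: "'a \<Rightarrow> 'b::euclidean_space"
  assumes p: "1 < p" and f: "f \<in> Lp_fun p M" and g: "g \<in> Lp_fun p M"
  shows "(\<lambda>x. f x - g x) \<in> Lp_fun p M" "Lp_norm p M (\<lambda>x. f x - g x) \<le> Lp_norm p M f + Lp_norm p M g"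
proof -
  have [measurable]: "g \<in> borel_measurable M" using Lp_fun_measurable g by auto
  have g': "(\<lambda>x. - g x) \<in> Lp_fun p M"
    by (rule Lp_fun_dominated(1)[OF p g, of _ 1]) auto
  have "Lp_norm p M (\<lambda>x. - g x) = Lp_norm p M g" by (rule Lp_norm_cong_norm) simp
  then show "(\<lambda>x. f x - g x) \<in> Lp_fun p M" "Lp_norm p M (\<lambda>x. f x - g x) \<le> Lp_norm p M f + Lp_norm p M g"
    using Lp_Minkowski[OF p f g'] by auto
qed

lemma Lp_norm_diff_commute:
  "Lp_norm p M (\<lambda>x. f x - g x) = Lp_norm p M (\<lambda>x. g x - f x)"
  by (rule Lp_norm_cong_norm) (rule norm_minus_commute)

lemma Lp_norm_diff_triangle:
  fixes f g h :: "'a \<Rightarrow> 'b::euclidean_space"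
  assumes "1 < p" "f \<in> Lp_fun p M" "g \<in> Lp_fun p M" "h \<in> Lp_fun p M"
  shows "Lp_norm p M (\<lambda>x. f x - h x) \<le> Lp_norm p M (\<lambda>x. f x - g x) + Lp_norm p M (\<lambda>x. g x - h x)"
  using Lp_Minkowski(2)[OF assms(1) Lp_diff(1)[OF assms(1,2,3)] Lp_diff(1)[OF assms(1,3,4)]] by simp

lemma Lp_norm_eq_0_iff:
  assumes p: "1 < p" and f: "f \<in> Lp_fun p M"
  shows "Lp_norm p M f = 0 \<longleftrightarrow> (AE x in M. f x = 0)"
proof
  have [measurable]: "f \<in> borel_measurable M" using Lp_fun_measurable f by auto
  show "Lp_norm p M f = 0" if "AE x in M. f x = 0"
    using Lp_norm_cong_AE[of f M "\<lambda>x. 0" p] that Lp_zero(2)[OF p] by simp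
  show "AE x in M. f x = 0" if 0: "Lp_norm p M f = 0"
    using p
  proof (cases rule: exponent_cases)
    case 1
    show ?thesis using Lp_norm_infinity_AE[of f M] f 0 by (simp add: 1)
  next
    case 2
    then have "(LINT x|M. norm (f x) powr enn2real p) = 0"
      using Lp_norm_powr[OF 2, of M f] 0 by simp
    moreover have "integrable M (\<lambda>x. norm (f x) powr enn2real p)" using f 2 by (simp add: Lp_fun_finite_iff)
    ultimately have "AE x in M. norm (f x) powr enn2real p = 0"
      by (subst (asm) integral_nonneg_eq_0_iff_AE) auto
    then show ?thesis by simp
  qed
qed

text \<open>Beyond \<open>l\<close> the factor t^(1-q) is at most l^(1-q), its exponent being
  negative. Integrated with \<open>l\<close> equal to the L_p norm, this does the work of Hoelder's
  inequality against the constant 1.\<close>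

lemma le_add_scaled_powr:
  assumes "1 < q" "0 < l" "0 \<le> (t::real)"
  shows "t \<le> l + l powr (1 - q) * t powr q"
proof (cases "t \<le> l")
  case False
  then have t: "0 < t" using assms by simp
  have "t = t powr (1 - q) * t powr q" using t by (simp add: powr_add[symmetric])
  also have "\<dots> \<le> l powr (1 - q) * t powr q"
    using False assms by (intro mult_right_mono powr_mono2') auto
  finally show ?thesis using assms by simp
qed (use assms in \<open>simp add: add_increasing2\<close>)

lemma Lp_imp_L1:
  fixes f :: "'a \<Rightarrow> 'b::euclidean_space"
  assumes M: "finite_measure M" and p: "1 < p" and f: "f \<in> Lp_fun p M"
  shows "integrable M f" "(LINT x|M. norm (f x)) \<le> (measure M (space M) + 1) * Lp_norm p M f"
proof -
  interpret finite_measure M by fact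
  have [measurable]: "f \<in> borel_measurable M" using Lp_fun_measurable f by auto
  have "integrable M f \<and> (LINT x|M. norm (f x)) \<le> (measure M (space M) + 1) * Lp_norm p M f"
    using p
  proof (cases rule: exponent_cases)
    case 1
    have AE: "AE x in M. norm (f x) \<le> Lp_norm p M f" using Lp_norm_infinity_AE f 1 by blast
    then have "integrable M f"
      by (intro integrable_const_bound[of _ "Lp_norm p M f"]) auto
    moreover then have "(LINT x|M. norm (f x)) \<le> (LINT x|M. Lp_norm p M f)"
      using AE by (intro integral_mono_AE) auto
    ultimately show ?thesis using Lp_norm_nonneg[of p M f] by (simp add: algebra_simps)
  next
    case 2
    let ?q = "enn2real p"
    have intq: "integrable M (\<lambda>x. norm (f x) powr ?q)" using f 2 by (simp add: Lp_fun_finite_iff)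
    have int: "integrable M f"
    proof (rule Bochner_Integration.integrable_bound)
      show "integrable M (\<lambda>x. 1 + norm (f x) powr ?q)" using intq by simp
      show "AE x in M. norm (f x) \<le> norm (1 + norm (f x) powr ?q)"
        using le_add_scaled_powr[OF 2(2), of 1] by simp
    qed simp
    moreover have "(LINT x|M. norm (f x)) \<le> (measure M (space M) + 1) * Lp_norm p M f"
    proof (cases "Lp_norm p M f = 0")
      case True
      then have "AE x in M. norm (f x) = 0" using Lp_norm_eq_0_iff[OF p f] by simp
      then have "(LINT x|M. norm (f x)) = 0" by (simp add: integral_eq_zero_AE)
      then show ?thesis using True by simp
    next
      case False
      define N where "N = Lp_norm p M f"
      have N: "0 < N" using False Lp_norm_nonneg[of p M f] by (simp add: N_def)
      \<comment> \<open>The two summands integrate to \<open>measure M (space M) * N\<close> and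
        \<open>N\<close>, which is the origin of the constant
        \<open>measure M (space M) + 1\<close>.\<close>
      have "(LINT x|M. norm (f x)) \<le> (LINT x|M. N + N powr (1 - ?q) * norm (f x) powr ?q)"
        using int intq le_add_scaled_powr[OF 2(2) N] by (intro integral_mono) auto
      also have "\<dots> = measure M (space M) * N + N powr (1 - ?q) * N powr ?q"
        using intq Lp_norm_powr[OF 2, of M f] by (simp add: N_def)
      also have "N powr (1 - ?q) * N powr ?q = N" using N by (simp add: powr_add[symmetric])
      finally show ?thesis by (simp add: N_def algebra_simps)
    qed
    ultimately show ?thesis by blast
  qed
  then show "integrable M f" "(LINT x|M. norm (f x)) \<le> (measure M (space M) + 1) * Lp_norm p M f" by auto
qed

section \<open>Lower semicontinuity of the norm, completeness and uniform convexity\<close>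

lemma Lp_Fatou:
  fixes f :: "'a \<Rightarrow> 'b::euclidean_space"
  assumes p: "1 < p" and F: "\<And>n. F n \<in> Lp_fun p M" "\<And>n. Lp_norm p M (F n) \<le> c"
    and f: "f \<in> borel_measurable M" and lim: "AE x in M. (\<lambda>n. F n x) \<longlonglongrightarrow> f x"
  shows "f \<in> Lp_fun p M" "Lp_norm p M f \<le> c"
proof -
  have c: "0 \<le> c" using F(2)[of 0] Lp_norm_nonneg[of p M "F 0"] by simp
  have [measurable]: "\<And>n. F n \<in> borel_measurable M" "f \<in> borel_measurable M"
    using Lp_fun_measurable F(1) f by blast+
  have "f \<in> Lp_fun p M \<and> Lp_norm p M f \<le> c"
    using p
  proof (cases rule: exponent_cases)
    case 1
    \<comment> \<open>Countably many exceptional null sets are united into one.\<close>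
    have "AE x in M. \<forall>n. norm (F n x) \<le> Lp_norm p M (F n)"
      unfolding AE_all_countable using Lp_norm_infinity_AE F(1) 1 by blast
    with lim have "AE x in M. norm (f x) \<le> c"
    proof eventually_elim
      case (elim x)
      then show ?case
        using F(2) order_trans by (intro LIMSEQ_le_const2[OF tendsto_norm[OF elim(1)]]) blast
    qed
    then show ?thesis using Lp_fun_infinityI[OF f c] 1 by simp
  next
    case 2
    let ?q = "enn2real p"
    have "(\<integral>\<^sup>+x. ennreal (norm (f x) powr ?q) \<partial>M) = (\<integral>\<^sup>+x. liminf (\<lambda>n. ennreal (norm (F n x) powr ?q)) \<partial>M)"
    proof (rule nn_integral_cong_AE)
      show "AE x in M. ennreal (norm (f x) powr ?q) = liminf (\<lambda>n. ennreal (norm (F n x) powr ?q))"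
        using lim
      proof eventually_elim
        case (elim x)
        have "(\<lambda>n. norm (F n x) powr ?q) \<longlonglongrightarrow> norm (f x) powr ?q"
          using elim 2 by (intro tendsto_powr' tendsto_intros) auto
        then have "(\<lambda>n. ennreal (norm (F n x) powr ?q)) \<longlonglongrightarrow> ennreal (norm (f x) powr ?q)"
          by (rule tendsto_ennrealI)
        then show ?case by (rule lim_imp_Liminf[OF sequentially_bot, symmetric])
      qed
    qed
    also have "\<dots> \<le> liminf (\<lambda>n. \<integral>\<^sup>+x. ennreal (norm (F n x) powr ?q) \<partial>M)"
      by (rule nn_integral_liminf) measurable
    also have "\<dots> \<le> ennreal (c powr ?q)"
    proof (rule order_trans[OF Liminf_mono[of _ "\<lambda>n. ennreal (c powr ?q)"]])
      have "(\<integral>\<^sup>+x. ennreal (norm (F n x) powr ?q) \<partial>M) \<le> ennreal (c powr ?q)" for n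
        using F(1)[of n] F(2)[of n] c 2
        by (subst nn_integral_eq_integral) (auto simp: Lp_fun_finite_iff Lp_norm_le_iff intro!: ennreal_leI)
      then show "\<forall>\<^sub>F n in sequentially. (\<integral>\<^sup>+x. ennreal (norm (F n x) powr ?q) \<partial>M) \<le> ennreal (c powr ?q)" by simp
    qed (simp add: Liminf_const)
    finally show ?thesis using Lp_fun_finiteI[OF 2 c f] by simp
  qed
  then show "f \<in> Lp_fun p M" "Lp_norm p M f \<le> c" by auto
qed

text \<open>Riesz-Fischer: along a fast subsequence the increments are summable in L_1, hence
  absolutely summable almost everywhere. \<open>Lp_Fatou\<close> then shows that the pointwise limit
  is also the limit of the whole sequence in L_p.\<close>

theorem Lp_complete:
  fixes F :: "nat \<Rightarrow> 'a \<Rightarrow> 'b::euclidean_space"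
  assumes M: "finite_measure M" and p: "1 < p" and F: "\<And>n. F n \<in> Lp_fun p M"
    and Cauchy: "\<And>e. 0 < e \<Longrightarrow> \<exists>N. \<forall>m\<ge>N. \<forall>n\<ge>N. Lp_norm p M (\<lambda>x. F m x - F n x) < e"
  obtains G where "G \<in> Lp_fun p M" "(\<lambda>n. Lp_norm p M (\<lambda>x. F n x - G x)) \<longlonglongrightarrow> 0"
proof -
  have [measurable]: "\<And>n. F n \<in> borel_measurable M" using Lp_fun_measurable F by blast
  have "\<exists>N. \<forall>m\<ge>N. \<forall>n\<ge>N. Lp_norm p M (\<lambda>x. F m x - F n x) < (1 / 2) ^ k" for k
    using Cauchy[of "(1 / 2) ^ k"] by simp
  then obtain N where N: "\<And>k m n. N k \<le> m \<Longrightarrow> N k \<le> n \<Longrightarrow> Lp_norm p M (\<lambda>x. F m x - F n x) < (1 / 2) ^ k"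
    by metis
  \<comment> \<open>Cumulative sums make the indices monotone and at least \<open>N k\<close>; the
    summand \<open>k\<close> sends them to infinity.\<close>
  define r where "r k = k + (\<Sum>i\<le>k. N i)" for k
  have r: "N k \<le> r k" "k \<le> r k" "r k \<le> r (Suc k)" for k
  proof -
    have "N k \<le> (\<Sum>i\<le>k. N i)" by (rule member_le_sum) auto
    then show "N k \<le> r k" by (simp add: r_def)
  qed (auto simp: r_def)
  define D where "D k x = F (r (Suc k)) x - F (r k) x" for k x
  have [measurable]: "D k \<in> borel_measurable M" for k unfolding D_def by measurable
  define C where "C = measure M (space M) + 1"
  have D: "(\<integral>\<^sup>+x. ennreal (norm (D k x)) \<partial>M) \<le> ennreal (C * (1 / 2) ^ k)" for k
  proof -
    have Dk: "D k \<in> Lp_fun p M" unfolding D_def by (intro Lp_diff F p)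
    have "Lp_norm p M (D k) \<le> (1 / 2) ^ k"
      unfolding D_def by (rule less_imp_le[OF N[OF order_trans[OF r(1) r(3)] r(1)]])
    then have "C * Lp_norm p M (D k) \<le> C * (1 / 2) ^ k" by (intro mult_left_mono) (auto simp: C_def)
    then show ?thesis
      using Lp_imp_L1[OF M p Dk] by (subst nn_integral_eq_integral) (auto simp: C_def intro!: ennreal_leI)
  qed
  have "(\<integral>\<^sup>+x. (\<Sum>k. ennreal (norm (D k x))) \<partial>M) = (\<Sum>k. \<integral>\<^sup>+x. ennreal (norm (D k x)) \<partial>M)"
    by (rule nn_integral_suminf) measurable
  also have "\<dots> \<le> (\<Sum>k. ennreal (C * (1 / 2) ^ k))"
    by (intro suminf_le D) auto
  also have "\<dots> = ennreal (\<Sum>k. C * (1 / 2) ^ k)"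
    by (intro suminf_ennreal2 summable_mult summable_geometric) (auto simp: C_def)
  finally have "(\<integral>\<^sup>+x. (\<Sum>k. ennreal (norm (D k x))) \<partial>M) < top"
    by (rule le_less_trans) simp
  then have "(\<integral>\<^sup>+x. (\<Sum>k. ennreal (norm (D k x))) \<partial>M) \<noteq> \<infinity>"
    by simp
  then have AE: "AE x in M. (\<Sum>k. ennreal (norm (D k x))) \<noteq> \<infinity>"
    by (intro nn_integral_PInf_AE) auto
  define G where "G x = lim (\<lambda>k. F (r k) x)" for x
  have [measurable]: "G \<in> borel_measurable M" unfolding G_def by measurable
  have lim: "AE x in M. (\<lambda>k. F (r k) x) \<longlonglongrightarrow> G x"
    using AE
  proof eventually_elim
    case (elim x)
    then have "summable (\<lambda>k. norm (D k x))" by (intro summable_suminf_not_top) auto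
    then have "summable (\<lambda>k. D k x)" by (rule summable_norm_cancel)
    then have "convergent (\<lambda>n. F (r 0) x + (\<Sum>k<n. D k x))"
      by (intro convergent_add convergent_const) (simp add: summable_iff_convergent)
    moreover have "F (r 0) x + (\<Sum>k<n. D k x) = F (r n) x" for n
      unfolding D_def by (subst sum_lessThan_telescope) simp
    ultimately show ?case by (simp add: G_def convergent_LIMSEQ_iff)
  qed
  \<comment> \<open>Fatou is applied to \<open>F n - F (r (k + n0))\<close> as \<open>k\<close>
    grows. The shift keeps every index above \<open>n0\<close>, so that the Cauchy estimate holds
    for each \<open>k\<close>.\<close>
  have close: "\<exists>n0. \<forall>n\<ge>n0. (\<lambda>x. F n x - G x) \<in> Lp_fun p M \<and> Lp_norm p M (\<lambda>x. F n x - G x) \<le> e" if e: "0 < e" for e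
  proof -
    obtain n0 where n0: "\<And>m n. n0 \<le> m \<Longrightarrow> n0 \<le> n \<Longrightarrow> Lp_norm p M (\<lambda>x. F m x - F n x) < e" using Cauchy[OF e] by blast
    have "(\<lambda>x. F n x - G x) \<in> Lp_fun p M \<and> Lp_norm p M (\<lambda>x. F n x - G x) \<le> e" if "n0 \<le> n" for n
    proof (intro conjI)
      have 1: "(\<lambda>x. F n x - F (r (k + n0)) x) \<in> Lp_fun p M" for k by (intro Lp_diff F p)
      have "n0 \<le> r (k + n0)" for k using r(2)[of "k + n0"] by simp
      then have 2: "Lp_norm p M (\<lambda>x. F n x - F (r (k + n0)) x) \<le> e" for k
        using n0 that by (blast intro: less_imp_le)
      have 3: "AE x in M. (\<lambda>k. F n x - F (r (k + n0)) x) \<longlonglongrightarrow> F n x - G x"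
        using lim
      proof eventually_elim
        case (elim x)
        from LIMSEQ_ignore_initial_segment[OF elim, of n0] show ?case by (intro tendsto_intros)
      qed
      show "(\<lambda>x. F n x - G x) \<in> Lp_fun p M" "Lp_norm p M (\<lambda>x. F n x - G x) \<le> e"
        using Lp_Fatou[OF p 1 2 _ 3] by auto
    qed
    then show ?thesis by blast
  qed
  obtain n where "(\<lambda>x. F n x - G x) \<in> Lp_fun p M" using close[of 1] by auto
  from Lp_diff(1)[OF p F[of n] this] have "G \<in> Lp_fun p M" by simp
  moreover have "(\<lambda>n. Lp_norm p M (\<lambda>x. F n x - G x)) \<longlonglongrightarrow> 0"
  proof (rule LIMSEQ_I)
    fix e :: real assume "0 < e"
    then obtain n0 where n0: "\<And>n. n0 \<le> n \<Longrightarrow> Lp_norm p M (\<lambda>x. F n x - G x) \<le> e / 2"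
      using close[of "e / 2"] by auto
    have "norm (Lp_norm p M (\<lambda>x. F n x - G x) - 0) < e" if "n0 \<le> n" for n
      using n0[OF that] Lp_norm_nonneg[of p M "\<lambda>x. F n x - G x"] \<open>0 < e\<close> by simp
    then show "\<exists>no. \<forall>n\<ge>no. norm (Lp_norm p M (\<lambda>x. F n x - G x) - 0) < e" by blast
  qed
  ultimately show ?thesis using that by blast
qed

text \<open>Integration of the pointwise inequality \<open>pt\<close> bounds the distance by a small
  multiple of the norms plus \<open>C\<close> times the integrated defect. The constants stem from
  that inequality alone, so \<open>d\<close> serves all functions.\<close>

theorem Lp_uniformly_convex:
  assumes p: "1 < p" "p < \<infinity>" and e: "0 < e"
  obtains d where "0 < d"
    "\<And>f g :: 'a \<Rightarrow> 'b::euclidean_space. f \<in> Lp_fun p M \<Longrightarrow> g \<in> Lp_fun p M \<Longrightarrow> Lp_norm p M f \<le> 1 \<Longrightarrow> Lp_norm p M g \<le> 1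
      \<Longrightarrow> 2 - d \<le> Lp_norm p M (\<lambda>x. f x + g x) \<Longrightarrow> Lp_norm p M (\<lambda>x. f x - g x) \<le> e"
proof -
  define q where "q = enn2real p"
  have pq: "p \<noteq> \<infinity>" "1 < enn2real p" and q: "1 < q" using p exponent_cases[OF p(1)] by (auto simp: q_def)
  \<comment> \<open>The two unit norms contribute \<open>2 * \<eta>\<close>, half of e^q; the other
    half is left to the defect.\<close>
  define \<eta> where "\<eta> = e powr q / 4"
  have \<eta>: "0 < \<eta>" using e by (simp add: \<eta>_def)
  obtain C where C: "0 \<le> C"
    and pt: "\<And>a b :: 'b. norm (a - b) powr q \<le> \<eta> * (norm a powr q + norm b powr q) + C * convexity_defect q a b"
    using norm_diff_powr_le_defect[OF q \<eta>] by blast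
  \<comment> \<open>\<open>y\<close> is a lower bound for the q-th power of the norm of the midpoint
    that keeps \<open>C * (1 - y)\<close> below half of e^q. The denominator has
    \<open>C + 1\<close> because \<open>C\<close> may be 0. The threshold \<open>2 - d\<close> is
    then twice the q-th root of \<open>y\<close>.\<close>
  define y where "y = max 0 (1 - e powr q / (2 * (C + 1)))"
  have y: "0 \<le> y" "y < 1" using C e by (auto simp: y_def)
  define d where "d = 2 * (1 - y powr (1 / q))"
  have "y powr (1 / q) < 1 powr (1 / q)" using y q by (intro powr_less_mono2) auto
  then have d: "0 < d" by (simp add: d_def)
  have "Lp_norm p M (\<lambda>x. f x - g x) \<le> e"
    if f: "f \<in> Lp_fun p M" "Lp_norm p M f \<le> 1" and g: "g \<in> Lp_fun p M" "Lp_norm p M g \<le> 1"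
      and fg: "2 - d \<le> Lp_norm p M (\<lambda>x. f x + g x)" for f g :: "'a \<Rightarrow> 'b"
  proof -
    have int: "integrable M (\<lambda>x. norm (f x) powr q)" "integrable M (\<lambda>x. norm (g x) powr q)"
        "integrable M (\<lambda>x. norm (f x + g x) powr q)" "integrable M (\<lambda>x. norm (f x - g x) powr q)"
      using f(1) g(1) Lp_Minkowski(1)[OF p(1) f(1) g(1)] Lp_diff(1)[OF p(1) f(1) g(1)] pq(1)
      by (auto simp: Lp_fun_finite_iff q_def)
    have n: "(LINT x|M. norm (h x) powr q) = Lp_norm p M h powr q" for h :: "'a \<Rightarrow> 'b"
      using Lp_norm_powr[OF pq, of M h] by (simp add: q_def)
    have le1: "Lp_norm p M h powr q \<le> 1" if "Lp_norm p M h \<le> 1" for h :: "'a \<Rightarrow> 'b"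
      using powr_mono2[OF _ Lp_norm_nonneg that, of q] q by simp
    have "y = (y powr (1 / q)) powr q" using y q by (simp add: powr_powr)
    also have "\<dots> \<le> (Lp_norm p M (\<lambda>x. f x + g x) / 2) powr q"
      using q fg by (intro powr_mono2) (auto simp: d_def)
    finally have mid: "y \<le> Lp_norm p M (\<lambda>x. f x + g x) powr q / 2 powr q" by (simp add: powr_divide Lp_norm_nonneg)
    have "Lp_norm p M (\<lambda>x. f x - g x) powr q = (LINT x|M. norm (f x - g x) powr q)" using n by simp
    also have "\<dots> \<le> (LINT x|M. \<eta> * (norm (f x) powr q + norm (g x) powr q)
        + C * ((norm (f x) powr q + norm (g x) powr q) / 2 - norm (f x + g x) powr q / 2 powr q))"
      using int pt by (intro integral_mono) (auto simp: convexity_defect_def powr_divide)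
    also have "\<dots> = \<eta> * (Lp_norm p M f powr q + Lp_norm p M g powr q)
        + C * ((Lp_norm p M f powr q + Lp_norm p M g powr q) / 2 - Lp_norm p M (\<lambda>x. f x + g x) powr q / 2 powr q)"
      using int by (simp add: n)
    also have "\<dots> \<le> \<eta> * (1 + 1) + C * ((1 + 1) / 2 - y)"
      using mid le1[OF f(2)] le1[OF g(2)] \<eta> C
      by (intro add_mono mult_left_mono diff_mono divide_right_mono) auto
    also have "C * ((1 + 1) / 2 - y) \<le> C * (e powr q / (2 * (C + 1)))"
      using C by (intro mult_left_mono) (auto simp: y_def)
    also have "\<dots> \<le> e powr q / 2" using C by (simp add: field_simps)
    finally have "Lp_norm p M (\<lambda>x. f x - g x) powr q \<le> e powr q" by (simp add: \<eta>_def)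
    then show ?thesis
      using powr_less_mono2[of q e "Lp_norm p M (\<lambda>x. f x - g x)"] q e by fastforce
  qed
  then show ?thesis using that d by blast
qed

section \<open>Separability of \<open>L\<^sub>p\<close>\<close>

text \<open>The differences are bounded by \<open>2 * w\<close>, so the q-th power of
  \<open>2 * w\<close> is an integrable majorant for ordinary dominated convergence.\<close>

lemma Lp_dominated_convergence:
  fixes f :: "'a \<Rightarrow> 'b::euclidean_space"
  assumes p: "1 < p" "p < \<infinity>"
    and f: "f \<in> borel_measurable M" and g: "\<And>n. g n \<in> borel_measurable M"
    and w: "integrable M (\<lambda>x. w x powr enn2real p)"
    and le: "\<And>n. AE x in M. norm (g n x) \<le> w x" and lim: "AE x in M. (\<lambda>n. g n x) \<longlonglongrightarrow> f x"
  shows "f \<in> Lp_fun p M" "\<And>n. g n \<in> Lp_fun p M" "(\<lambda>n. Lp_norm p M (\<lambda>x. f x - g n x)) \<longlonglongrightarrow> 0"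
proof -
  define q where "q = enn2real p"
  have pq: "p \<noteq> \<infinity>" "1 < enn2real p" and q: "1 < q" using p exponent_cases[OF p(1)] by (auto simp: q_def)
  have [measurable]: "f \<in> borel_measurable M" "\<And>n. g n \<in> borel_measurable M" by fact+
  have wq: "integrable M (\<lambda>x. w x powr q)" using w by (simp add: q_def)
  have dom: "h \<in> Lp_fun p M" if [measurable]: "h \<in> borel_measurable M" and "AE x in M. norm (h x) \<le> w x" for h :: "'a \<Rightarrow> 'b"
  proof -
    have "integrable M (\<lambda>x. norm (h x) powr q)"
    proof (rule Bochner_Integration.integrable_bound[OF wq])
      show "AE x in M. norm (norm (h x) powr q) \<le> norm (w x powr q)"
        using that(2) q by (auto elim!: eventually_mono intro!: powr_mono2)
    qed simp
    then show ?thesis using pq by (simp add: Lp_fun_finite_iff q_def)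
  qed
  then show "g n \<in> Lp_fun p M" for n using le by simp
  have "AE x in M. \<forall>n. norm (g n x) \<le> w x" using le by (simp add: AE_all_countable)
  with lim have "AE x in M. norm (f x) \<le> w x"
  proof eventually_elim
    case (elim x)
    then show ?case by (intro LIMSEQ_le_const2[OF tendsto_norm[OF elim(1)]]) auto
  qed
  then have fw: "AE x in M. norm (f x) \<le> w x" .
  then show "f \<in> Lp_fun p M" using dom by simp
  have "(\<lambda>n. LINT x|M. norm (f x - g n x) powr q) \<longlonglongrightarrow> (LINT x|M. 0)"
  proof (rule integral_dominated_convergence)
    show "integrable M (\<lambda>x. 2 powr q * w x powr q)" using wq by simp
    show "AE x in M. (\<lambda>n. norm (f x - g n x) powr q) \<longlonglongrightarrow> 0"
      using lim
    proof eventually_elim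
      case (elim x)
      have "(\<lambda>n. f x - g n x) \<longlonglongrightarrow> f x - f x" by (intro tendsto_intros elim)
      then have "(\<lambda>n. norm (f x - g n x)) \<longlonglongrightarrow> 0" by (simp add: tendsto_norm_zero)
      then show ?case using q by (intro tendsto_zero_powrI) auto
    qed
    fix n
    show "AE x in M. norm (norm (f x - g n x) powr q) \<le> 2 powr q * w x powr q"
      using fw le[of n]
    proof eventually_elim
      case (elim x)
      then have "norm (f x - g n x) \<le> 2 * w x" using norm_triangle_ineq4[of "f x" "g n x"] by simp
      then have "norm (f x - g n x) powr q \<le> (2 * w x) powr q" using q by (intro powr_mono2) auto
      then show ?case by (simp add: powr_mult)
    qed
  qed simp_all
  then have "(\<lambda>n. (LINT x|M. norm (f x - g n x) powr q) powr (1 / q)) \<longlonglongrightarrow> 0"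
    using q by (intro tendsto_zero_powrI) auto
  then show "(\<lambda>n. Lp_norm p M (\<lambda>x. f x - g n x)) \<longlonglongrightarrow> 0"
    using pq by (simp add: Lp_norm_def q_def)
qed

text \<open>Number of the half-open square of side 1/(n+1) that contains the point;
  \<open>grid_point\<close> returns the lower left corner of a square.\<close>

definition grid_index :: "nat \<Rightarrow> complex \<Rightarrow> int \<times> int" where
  "grid_index n z = (\<lfloor>real (Suc n) * Re z\<rfloor>, \<lfloor>real (Suc n) * Im z\<rfloor>)"

definition grid_point :: "nat \<Rightarrow> int \<times> int \<Rightarrow> complex" where
  "grid_point n c = Complex (of_int (fst c) / real (Suc n)) (of_int (snd c) / real (Suc n))"

text \<open>Step functions encoded by finite association lists of squares and values, so that values
  from a countable set give only countably many of them.\<close>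

definition grid_fun :: "nat \<Rightarrow> ((int \<times> int) \<times> 'b) list \<Rightarrow> complex \<Rightarrow> 'b::zero" where
  "grid_fun n L z = (case map_of L (grid_index n z) of None \<Rightarrow> 0 | Some v \<Rightarrow> v)"

text \<open>The function factors through a countable discrete index set, on which every function is
  measurable.\<close>

lemma borel_measurable_grid_fun: "grid_fun n L \<in> borel_measurable borel"
proof -
  have "grid_index n \<in> measurable borel (count_space UNIV \<Otimes>\<^sub>M count_space UNIV)"
    unfolding grid_index_def by measurable
  then have "grid_index n \<in> measurable borel (count_space UNIV)"
    by (simp add: pair_measure_countable)
  then have "(\<lambda>z. (\<lambda>c. case map_of L c of None \<Rightarrow> 0 | Some v \<Rightarrow> v) (grid_index n z)) \<in> borel_measurable borel"
    by (rule measurable_compose) simp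
  then show ?thesis by (simp add: grid_fun_def[abs_def])
qed

lemma LIMSEQ_grid_point: "(\<lambda>n. grid_point n (grid_index n z)) \<longlonglongrightarrow> z"
proof -
  have "(\<lambda>n. of_int \<lfloor>real (Suc n) * x\<rfloor> / real (Suc n)) \<longlonglongrightarrow> x" for x :: real
  proof (rule tendsto_sandwich)
    have "x - inverse (real (Suc n)) \<le> of_int \<lfloor>real (Suc n) * x\<rfloor> / real (Suc n)"
      "of_int \<lfloor>real (Suc n) * x\<rfloor> / real (Suc n) \<le> x" for n
    proof -
      have "real (Suc n) * x - 1 \<le> of_int \<lfloor>real (Suc n) * x\<rfloor>" "of_int \<lfloor>real (Suc n) * x\<rfloor> \<le> real (Suc n) * x"
        by linarith+
      from this[THEN divide_right_mono, of "real (Suc n)"]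
      show "x - inverse (real (Suc n)) \<le> of_int \<lfloor>real (Suc n) * x\<rfloor> / real (Suc n)"
        "of_int \<lfloor>real (Suc n) * x\<rfloor> / real (Suc n) \<le> x"
        by (simp_all add: diff_divide_distrib inverse_eq_divide del: of_nat_Suc)
    qed
    then show "\<forall>\<^sub>F n in sequentially. x - inverse (real (Suc n)) \<le> of_int \<lfloor>real (Suc n) * x\<rfloor> / real (Suc n)"
      "\<forall>\<^sub>F n in sequentially. of_int \<lfloor>real (Suc n) * x\<rfloor> / real (Suc n) \<le> x"
      by auto
    have "(\<lambda>n. x - inverse (real (Suc n))) \<longlonglongrightarrow> x - 0"
      by (intro tendsto_intros LIMSEQ_inverse_real_of_nat)
    then show "(\<lambda>n. x - inverse (real (Suc n))) \<longlonglongrightarrow> x" by simp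
  qed simp
  from tendsto_Complex[OF this[of "Re z"] this[of "Im z"]] show ?thesis
    by (simp add: grid_point_def grid_index_def del: of_nat_Suc)
qed

lemma finite_grid_index_image:
  assumes "bounded \<Omega>"
  shows "finite (grid_index n ` \<Omega>)"
proof -
  obtain R where R: "\<And>z. z \<in> \<Omega> \<Longrightarrow> cmod z \<le> R" using assms by (auto simp: bounded_iff)
  define N where "N = \<lceil>real (Suc n) * R\<rceil> + 1"
  have *: "\<lfloor>real (Suc n) * x\<rfloor> \<in> {- N..N}" if "\<bar>x\<bar> \<le> R" for x
  proof -
    have "\<bar>real (Suc n) * x\<bar> \<le> real (Suc n) * R"
      using that unfolding abs_mult by (intro mult_mono) auto
    also have "real (Suc n) * R \<le> of_int \<lceil>real (Suc n) * R\<rceil>" by (rule le_of_int_ceiling)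
    finally have "\<bar>real (Suc n) * x\<bar> \<le> of_int N - 1" by (simp add: N_def)
    then show ?thesis unfolding atLeastAtMost_iff by (auto simp: le_floor_iff floor_le_iff)
  qed
  have "grid_index n z \<in> {- N..N} \<times> {- N..N}" if "z \<in> \<Omega>" for z
    unfolding grid_index_def
    using *[of "Re z"] *[of "Im z"] R[OF that] abs_Re_le_cmod[of z] abs_Im_le_cmod[of z]
    by (simp del: of_nat_Suc atLeastAtMost_iff)
  then have "grid_index n ` \<Omega> \<subseteq> {- N..N} \<times> {- N..N}" by blast
  then show ?thesis by (rule finite_subset) auto
qed

text \<open>Sampling at the corners followed by rounding into the dense set \<open>E\<close>. A
  bounded set meets finitely many squares, so a finite list suffices. Corners may lie outside
  \<open>\<Omega>\<close>, hence \<open>g\<close> is sampled on the whole plane.\<close>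

lemma grid_fun_approx:
  fixes g :: "complex \<Rightarrow> 'b::real_normed_vector"
  assumes \<Omega>: "bounded \<Omega>" and E: "\<And>U. open U \<Longrightarrow> U \<noteq> {} \<Longrightarrow> \<exists>v\<in>E. v \<in> U" and e: "0 < e"
  obtains L where "L \<in> lists (UNIV \<times> E)" "\<And>z. z \<in> \<Omega> \<Longrightarrow> dist (g (grid_point n (grid_index n z))) (grid_fun n L z) < e"
proof -
  have "\<exists>v\<in>E. dist (g (grid_point n c)) v < e" for c
    using E[of "ball (g (grid_point n c)) e"] e by auto
  then obtain v where v: "\<And>c. v c \<in> E" "\<And>c. dist (g (grid_point n c)) (v c) < e" by metis
  obtain xs where xs: "set xs = grid_index n ` \<Omega>"
    using finite_list[OF finite_grid_index_image[OF \<Omega>]] by blast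
  define L where "L = map (\<lambda>c. (c, v c)) xs"
  show ?thesis
  proof (rule that)
    show "L \<in> lists (UNIV \<times> E)" using v by (auto simp: L_def)
    show "dist (g (grid_point n (grid_index n z))) (grid_fun n L z) < e" if "z \<in> \<Omega>" for z
      using v(2) that by (simp add: grid_fun_def L_def map_of_map_restrict restrict_map_def xs)
  qed
qed

lemma borel_measurable_lebesgue_onI: "f \<in> borel_measurable borel \<Longrightarrow> f \<in> borel_measurable (lebesgue_on S)"
  by (simp add: measurable_completion measurable_restrict_space1)

text \<open>The approximable functions are enlarged in three stages: bounded continuous functions by
  step functions on grids, bounded measurable functions by continuous ones, all of L_p by
  truncation. Each stage is a dominated limit.\<close>

theorem Lp_separable:
  fixes \<Omega> :: "complex set"
  assumes p: "1 < p" "p < \<infinity>" and \<Omega>: "bounded \<Omega>" "\<Omega> \<in> sets lebesgue"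
  obtains D :: "(complex \<Rightarrow> 'b::euclidean_space) set" where "countable D" "D \<subseteq> Lp_fun p (lebesgue_on \<Omega>)"
    "\<And>f e. f \<in> Lp_fun p (lebesgue_on \<Omega>) \<Longrightarrow> 0 < e \<Longrightarrow> \<exists>d\<in>D. Lp_norm p (lebesgue_on \<Omega>) (\<lambda>x. f x - d x) < e"
proof -
  let ?M = "lebesgue_on \<Omega>"
  have "\<Omega> \<in> lmeasurable" using \<Omega> bounded_set_imp_lmeasurable by blast
  then interpret finite_measure ?M by (rule finite_measure_lebesgue_on)
  have AE_in: "AE z in ?M. z \<in> \<Omega>" using AE_space[of ?M] by simp
  obtain E :: "'b set" where E: "countable E" "\<And>U. open U \<Longrightarrow> U \<noteq> {} \<Longrightarrow> \<exists>v\<in>E. v \<in> U"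
    using countable_dense_setE by blast
  define D where "D = (\<lambda>(n, L). grid_fun n L) ` (UNIV \<times> lists (UNIV \<times> E)) \<inter> Lp_fun p ?M"
  have "countable (lists ((UNIV :: (int \<times> int) set) \<times> E))" using E(1) by (intro countable_lists countable_SIGMA) auto
  then have D: "countable D" unfolding D_def by (intro countable_Int1 countable_image countable_SIGMA) auto
  \<comment> \<open>The closure of \<open>D\<close> in L_p; \<open>limit\<close> says that it is
    sequentially closed.\<close>
  define cl where "cl = {f \<in> Lp_fun p ?M. \<forall>e>0. \<exists>d\<in>D. Lp_norm p ?M (\<lambda>x. f x - d x) < e}"
  have D_cl: "d \<in> cl" if "d \<in> D" for d
  proof -
    have "Lp_norm p ?M (\<lambda>x. d x - d x) < e" if "0 < e" for e
      using that by (simp add: Lp_zero(2)[OF p(1)])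
    moreover have "d \<in> Lp_fun p ?M" using \<open>d \<in> D\<close> by (simp add: D_def)
    ultimately show ?thesis using \<open>d \<in> D\<close> unfolding cl_def by blast
  qed
  have limit: "f \<in> cl"
    if f: "f \<in> Lp_fun p ?M" and g: "\<And>n. g n \<in> cl" and lim: "(\<lambda>n. Lp_norm p ?M (\<lambda>x. f x - g n x)) \<longlonglongrightarrow> 0" for f g
    unfolding cl_def
  proof (intro CollectI conjI allI impI f)
    fix e :: real assume e: "0 < e"
    obtain n where n: "Lp_norm p ?M (\<lambda>x. f x - g n x) < e / 2"
      using order_tendstoD(2)[OF lim, of "e / 2"] e by (auto simp: eventually_sequentially)
    have "\<forall>e>0. \<exists>d\<in>D. Lp_norm p ?M (\<lambda>x. g n x - d x) < e" using g[of n] by (simp add: cl_def)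
    from this[rule_format, of "e / 2"] e
    obtain d where d: "d \<in> D" "Lp_norm p ?M (\<lambda>x. g n x - d x) < e / 2" by auto
    have "Lp_norm p ?M (\<lambda>x. f x - d x) \<le> Lp_norm p ?M (\<lambda>x. f x - g n x) + Lp_norm p ?M (\<lambda>x. g n x - d x)"
      using f g[of n] d(1) by (intro Lp_norm_diff_triangle p) (auto simp: cl_def D_def)
    also have "\<dots> < e" using n d(2) by simp
    finally show "\<exists>d\<in>D. Lp_norm p ?M (\<lambda>x. f x - d x) < e" using d(1) by blast
  qed
  have continuous: "g \<in> cl" if g: "continuous_on UNIV g" and k: "\<And>z. norm (g z) \<le> k" for g k
  proof -
    have "\<exists>L\<in>lists (UNIV \<times> E). \<forall>z\<in>\<Omega>. dist (g (grid_point n (grid_index n z))) (grid_fun n L z) < inverse (real (Suc n))" for n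
      by (rule grid_fun_approx[OF \<Omega>(1) E(2), of "inverse (real (Suc n))" g n]) auto
    then obtain L where L: "\<And>n. L n \<in> lists (UNIV \<times> E)"
      "\<And>n z. z \<in> \<Omega> \<Longrightarrow> dist (g (grid_point n (grid_index n z))) (grid_fun n (L n) z) < inverse (real (Suc n))"
      by metis
    define s where "s n = grid_fun n (L n)" for n
    have meas: "g \<in> borel_measurable ?M" "s n \<in> borel_measurable ?M" for n
      unfolding s_def
      by (intro borel_measurable_lebesgue_onI borel_measurable_grid_fun borel_measurable_continuous_onI g)+
    \<comment> \<open>Samples are bounded by \<open>k\<close> and rounding changes them by less than
      1, so a constant majorant works on a set of finite measure.\<close>
    have w: "integrable ?M (\<lambda>z. (k + 1) powr enn2real p)" by simp
    have bound: "AE z in ?M. norm (s n z) \<le> k + 1" for n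
      using AE_in
    proof eventually_elim
      case (elim z)
      have "inverse (real (Suc n)) \<le> 1" by (simp add: field_simps)
      then have "norm (g (grid_point n (grid_index n z)) - s n z) < 1"
        using L(2)[OF elim, of n] unfolding s_def dist_norm by linarith
      then show ?case
        using k[of "grid_point n (grid_index n z)"]
          norm_triangle_ineq4[of "g (grid_point n (grid_index n z))" "g (grid_point n (grid_index n z)) - s n z"] by simp
    qed
    have conv: "AE z in ?M. (\<lambda>n. s n z) \<longlonglongrightarrow> g z"
      using AE_in
    proof eventually_elim
      case (elim z)
      have 1: "(\<lambda>n. g (grid_point n (grid_index n z))) \<longlonglongrightarrow> g z"
        using continuous_on_tendsto_compose[OF g LIMSEQ_grid_point[of z]] by simp
      have 2: "(\<lambda>n. dist (s n z) (g (grid_point n (grid_index n z)))) \<longlonglongrightarrow> 0"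
      proof (rule tendsto_sandwich[OF _ _ tendsto_const LIMSEQ_inverse_real_of_nat])
        show "\<forall>\<^sub>F n in sequentially. dist (s n z) (g (grid_point n (grid_index n z))) \<le> inverse (real (Suc n))"
          using L(2)[OF elim] by (auto simp: s_def dist_commute intro!: always_eventually less_imp_le)
      qed simp
      show ?case by (rule Lim_transform[OF 1]) (use 2 in \<open>simp add: dist_norm tendsto_norm_zero_iff\<close>)
    qed
    note * = Lp_dominated_convergence[OF p meas w bound conv]
    have "s n \<in> D" for n unfolding D_def using *(2)[of n] L(1)[of n] by (auto simp: s_def)
    then show ?thesis using limit[OF *(1) D_cl *(3)] by blast
  qed
  have bounded: "h \<in> cl" if h: "h \<in> borel_measurable ?M" and k: "\<And>z. norm (h z) \<le> k" for h k
  proof -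
    have "h measurable_on \<Omega>" using h \<Omega> by (simp add: measurable_on_iff_borel_measurable)
    then obtain N g where N: "negligible N" and g: "\<And>n. continuous_on UNIV (g n)"
      and lim: "\<And>z. z \<notin> N \<Longrightarrow> (\<lambda>n. g n z) \<longlonglongrightarrow> (if z \<in> \<Omega> then h z else 0)"
      unfolding measurable_on_def by blast
    have k0: "0 \<le> k" using k[of 0] norm_ge_zero order_trans by blast
    \<comment> \<open>The approximants \<open>g n\<close> carry no common bound. Projection onto the
      ball of radius \<open>k\<close> supplies one, preserves continuity and fixes the values of
      \<open>h\<close>, hence also the limit.\<close>
    define T where "T = closest_point (cball (0::'b) k)"
    have T: "continuous_on UNIV T" "norm (T v) \<le> k" "norm v \<le> k \<Longrightarrow> T v = v" for v
      using k0 continuous_on_closest_point[of "cball (0::'b) k"] closest_point_in_set[of "cball (0::'b) k" v]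
      by (auto simp: T_def closest_point_self)
    have gT: "continuous_on UNIV (\<lambda>z. T (g n z))" for n
      using continuous_on_compose2[OF T(1) g] by simp
    have meas: "(\<lambda>z. T (g n z)) \<in> borel_measurable ?M" for n
      by (intro borel_measurable_lebesgue_onI borel_measurable_continuous_onI gT)
    have "AE z in lebesgue. z \<notin> N" using N by (simp add: negligible_iff_null_sets AE_not_in)
    then have conv: "AE z in ?M. (\<lambda>n. T (g n z)) \<longlonglongrightarrow> h z"
      using \<Omega>(2)
    proof (subst AE_restrict_space_iff)
      assume "AE z in lebesgue. z \<notin> N"
      then show "AE z in lebesgue. z \<in> \<Omega> \<longrightarrow> (\<lambda>n. T (g n z)) \<longlonglongrightarrow> h z"
      proof eventually_elim
        case (elim z)
        have "(\<lambda>n. T (g n z)) \<longlonglongrightarrow> T (h z)" if "z \<in> \<Omega>"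
          using lim[OF elim] that by (intro continuous_on_tendsto_compose[OF T(1)]) auto
        then show ?case using T(3)[OF k] by simp
      qed
    qed simp
    have w: "integrable ?M (\<lambda>z. k powr enn2real p)" by simp
    note * = Lp_dominated_convergence[OF p h meas w _ conv]
    show ?thesis using limit[OF *(1) continuous[OF gT T(2)] *(3)] T(2) by simp
  qed
  have "f \<in> cl" if f: "f \<in> Lp_fun p ?M" for f
  proof -
    have [measurable]: "f \<in> borel_measurable ?M" using f by (rule Lp_fun_measurable)
    \<comment> \<open>Truncation by projection onto balls of growing radius: each value is
      eventually fixed, and no norm increases, so \<open>norm (f z)\<close> is a majorant.\<close>
    define T where "T n = closest_point (cball (0::'b) (real n))" for n
    have T: "continuous_on UNIV (T n)" "norm (T n v) \<le> real n" "norm v \<le> real n \<Longrightarrow> T n v = v" for n v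
      using continuous_on_closest_point[of "cball (0::'b) (real n)"] closest_point_in_set[of "cball (0::'b) (real n)" v]
      by (auto simp: T_def closest_point_self)
    have meas: "(\<lambda>z. T n (f z)) \<in> borel_measurable ?M" for n
      by (intro borel_measurable_continuous_on[OF T(1)]) simp
    have bound: "norm (T n v) \<le> norm v" for n v
      using T(2)[of n v] T(3)[of v n] by (cases "norm v \<le> real n") auto
    have conv: "(\<lambda>n. T n v) \<longlonglongrightarrow> v" for v
    proof (rule tendsto_eventually)
      obtain n where "norm v \<le> real n" using real_arch_simple by blast
      then show "\<forall>\<^sub>F n in sequentially. T n v = v"
        using T(3) by (auto simp: eventually_sequentially intro!: exI[of _ n])
    qed
    have w: "integrable ?M (\<lambda>z. norm (f z) powr enn2real p)" using f p by (simp add: Lp_fun_def split: if_splits)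
    have "(\<lambda>n. Lp_norm p ?M (\<lambda>z. f z - T n (f z))) \<longlonglongrightarrow> 0"
      by (rule Lp_dominated_convergence(3)[OF p Lp_fun_measurable[OF f] meas w]) (simp_all add: bound conv)
    then show ?thesis by (rule limit[OF f bounded[OF meas T(2)]])
  qed
  then show ?thesis using that[OF D] by (auto simp: D_def cl_def)
qed

section \<open>Bicomplex-valued functions\<close>

lemma bc_of_complex_simps [simp]:
  "Sc (bc_of_complex c) = c" "Vec (bc_of_complex c) = 0"
  "bc_of_complex 0 = 0" "bc_of_complex 1 = 1" "bc_of_complex (- 1) = - 1"
  by (simp_all add: bc_of_complex_def bicomplex_eq_iff)

lemma bc_of_complex_add: "bc_of_complex (c + d) = bc_of_complex c + bc_of_complex d"
  by (simp add: bc_of_complex_def bicomplex_eq_iff)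

lemma bc_of_complex_mult: "bc_of_complex (c * d) = bc_of_complex c * bc_of_complex d"
  by (simp add: bc_of_complex_def bicomplex_eq_iff)

lemma bc_cnj_simps [simp]: "Sc (bc_cnj W) = Sc W" "Vec (bc_cnj W) = - Vec W"
  by (simp_all add: bc_cnj_def)

lemma norm_bc_cnj: "norm (bc_cnj W) = norm W"
  by (simp add: norm_bicomplex_def)

lemma norm_Sc_le: "cmod (Sc W) \<le> norm W" and norm_Vec_le: "cmod (Vec W) \<le> norm W"
  by (simp_all add: norm_bicomplex_def real_le_rsqrt)

lemma norm_le_Sc_Vec: "norm W \<le> cmod (Sc W) + cmod (Vec W)"
  by (simp add: norm_bicomplex_def sqrt_sum_squares_le_sum)

lemma norm_bc_of_complex_mult: "norm (bc_of_complex c * W) = cmod c * norm W"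
  by (simp add: norm_bicomplex_def norm_mult power_mult_distrib distrib_left[symmetric] real_sqrt_mult)

text \<open>The factor 4 counts the four products of components. Some factor above 1 is unavoidable:
  for W = 1 + ij one has |W|^2 = 2, but |W^2| = 2 sqrt 2.\<close>

lemma norm_bc_mult_le: "norm (W * V) \<le> 4 * (norm W * norm V)" for W V :: bicomplex
proof -
  have *: "cmod (x * y) \<le> norm W * norm V" if "cmod x \<le> norm W" "cmod y \<le> norm V" for x y
    unfolding norm_mult using that by (intro mult_mono) auto
  have "norm (W * V) \<le> cmod (Sc W * Sc V - Vec W * Vec V) + cmod (Sc W * Vec V + Vec W * Sc V)"
    using norm_le_Sc_Vec[of "W * V"] by simp
  also have "\<dots> \<le> (cmod (Sc W * Sc V) + cmod (Vec W * Vec V)) + (cmod (Sc W * Vec V) + cmod (Vec W * Sc V))"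
    by (intro add_mono norm_triangle_ineq4 norm_triangle_ineq)
  also have "\<dots> \<le> 4 * (norm W * norm V)"
    using *[of "Sc W" "Sc V"] *[of "Vec W" "Vec V"] *[of "Sc W" "Vec V"] *[of "Vec W" "Sc V"]
    by (simp add: norm_Sc_le norm_Vec_le)
  finally show ?thesis .
qed

lemma bounded_linear_Sc: "bounded_linear Sc"
  by (rule bounded_linear_intro[of _ 1]) (simp_all add: norm_Sc_le)

lemma bounded_linear_Vec: "bounded_linear Vec"
  by (rule bounded_linear_intro[of _ 1]) (simp_all add: norm_Vec_le)

lemma bounded_linear_bc_of_complex: "bounded_linear bc_of_complex"
  by (rule bounded_linear_intro[of _ 1])
    (simp_all add: bc_of_complex_add bicomplex_eq_iff norm_bicomplex_def)

lemma bounded_linear_bc_cnj: "bounded_linear bc_cnj"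
  by (rule bounded_linear_intro[of _ 1]) (simp_all add: bicomplex_eq_iff norm_bc_cnj)

lemma bounded_bilinear_bc_mult: "bounded_bilinear (\<lambda>W V :: bicomplex. W * V)"
proof
  show "\<exists>K. \<forall>W V :: bicomplex. norm (W * V) \<le> norm W * norm V * K"
    using norm_bc_mult_le by (intro exI[of _ 4]) (simp add: mult.commute)
qed (simp_all add: algebra_simps)

lemmas continuous_on_bc_mult = bounded_bilinear.continuous_on[OF bounded_bilinear_bc_mult]

lemma borel_measurable_bounded_linear:
  assumes "bounded_linear h" "f \<in> borel_measurable M"
  shows "(\<lambda>x. h (f x)) \<in> borel_measurable M"
  using borel_measurable_continuous_on[OF linear_continuous_on[OF assms(1)] assms(2)] .

lemmas borel_measurable_bicomplex [measurable (raw)] =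
  borel_measurable_bounded_linear[OF bounded_linear_Sc]
  borel_measurable_bounded_linear[OF bounded_linear_Vec]
  borel_measurable_bounded_linear[OF bounded_linear_bc_of_complex]
  borel_measurable_bounded_linear[OF bounded_linear_bc_cnj]

lemma borel_measurable_bc_mult [measurable (raw)]:
  fixes f g :: "'a \<Rightarrow> bicomplex"
  assumes "f \<in> borel_measurable M" "g \<in> borel_measurable M"
  shows "(\<lambda>x. f x * g x) \<in> borel_measurable M"
proof (rule borel_measurable_continuous_Pair[OF assms])
  show "continuous_on UNIV (\<lambda>x. fst x * snd x :: bicomplex)"
    by (intro continuous_on_bc_mult continuous_intros)
qed

text \<open>Domination gives one inequality; the reverse one is the same estimate for the scalar
  \<open>1 / c\<close>.\<close>

lemma Lp_bc_scale:
  fixes F :: "'a \<Rightarrow> bicomplex"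
  assumes p: "1 < p" and F: "F \<in> Lp_fun p M"
  shows "(\<lambda>z. bc_of_complex c * F z) \<in> Lp_fun p M"
    "Lp_norm p M (\<lambda>z. bc_of_complex c * F z) = cmod c * Lp_norm p M F"
proof -
  have [measurable]: "F \<in> borel_measurable M" using F by (rule Lp_fun_measurable)
  have le: "(\<lambda>z. bc_of_complex c * F z) \<in> Lp_fun p M"
    "Lp_norm p M (\<lambda>z. bc_of_complex c * F z) \<le> cmod c * Lp_norm p M F" for c
    using Lp_fun_dominated[OF p F, of "\<lambda>z. bc_of_complex c * F z" "cmod c"]
    by (simp_all add: norm_bc_of_complex_mult)
  then show "(\<lambda>z. bc_of_complex c * F z) \<in> Lp_fun p M" by blast
  show "Lp_norm p M (\<lambda>z. bc_of_complex c * F z) = cmod c * Lp_norm p M F"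
  proof (cases "c = 0")
    case False
    have "Lp_norm p M F \<le> 1 * Lp_norm p M (\<lambda>z. bc_of_complex (1 / c) * (bc_of_complex c * F z))"
      using False by (simp add: mult.assoc[symmetric] flip: bc_of_complex_mult)
    also have "\<dots> \<le> cmod (1 / c) * Lp_norm p M (\<lambda>z. bc_of_complex c * F z)"
      using Lp_fun_dominated(2)[OF p le(1), of "\<lambda>z. bc_of_complex (1 / c) * (bc_of_complex c * F z)" "cmod (1 / c)"]
      by (simp add: norm_bc_of_complex_mult)
    finally have "cmod c * Lp_norm p M F \<le> Lp_norm p M (\<lambda>z. bc_of_complex c * F z)"
      using False by (simp add: norm_divide field_simps)
    then show ?thesis using le(2) by (rule antisym[rotated])
  qed (simp add: Lp_zero(2)[OF p])
qed

text \<open>Membership by components agrees with membership by norm, so the results for functions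
  into Euclidean spaces apply to bicomplex functions directly.\<close>

lemma bc_valued_Lp_fun:
  assumes p: "1 < p"
  shows "bc_valued (Lp_fun p M) = Lp_fun p M"
proof (intro equalityI subsetI)
  fix F :: "complex \<Rightarrow> bicomplex" assume F: "F \<in> Lp_fun p M"
  then have [measurable]: "F \<in> borel_measurable M" by (rule Lp_fun_measurable)
  show "F \<in> bc_valued (Lp_fun p M)"
    unfolding bc_valued_def
    using Lp_fun_dominated(1)[OF p F, of "\<lambda>z. Sc (F z)" 1] Lp_fun_dominated(1)[OF p F, of "\<lambda>z. Vec (F z)" 1]
    by (simp add: norm_Sc_le norm_Vec_le)
next
  fix F :: "complex \<Rightarrow> bicomplex" assume "F \<in> bc_valued (Lp_fun p M)"
  then have F: "(\<lambda>z. Sc (F z)) \<in> Lp_fun p M" "(\<lambda>z. Vec (F z)) \<in> Lp_fun p M" by (auto simp: bc_valued_def)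
  note [measurable] = F[THEN Lp_fun_measurable]
  have "(\<lambda>z. bc_of_complex (Sc (F z))) \<in> Lp_fun p M"
    by (rule Lp_fun_dominated(1)[OF p F(1), of _ 1]) (auto simp: norm_bicomplex_def)
  moreover have "(\<lambda>z. bc_j * bc_of_complex (Vec (F z))) \<in> Lp_fun p M"
    by (rule Lp_fun_dominated(1)[OF p F(2), of _ 1]) (auto simp: norm_bicomplex_def bc_j_def)
  ultimately have "(\<lambda>z. bc_of_complex (Sc (F z)) + bc_j * bc_of_complex (Vec (F z))) \<in> Lp_fun p M"
    by (rule Lp_Minkowski(1)[OF p])
  then show "F \<in> Lp_fun p M" by (simp flip: bicomplex_decompose)
qed

lemma bc_inner_measurable [measurable (raw)]:
  assumes [measurable]: "f \<in> borel_measurable M" "g \<in> borel_measurable M"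
  shows "(\<lambda>x. bc_inner (f x) (g x)) \<in> borel_measurable M"
proof -
  have "(\<lambda>x. cnj (Sc (g x))) \<in> borel_measurable M" "(\<lambda>x. cnj (Vec (g x))) \<in> borel_measurable M"
    by (rule borel_measurable_bounded_linear[OF bounded_linear_cnj], measurable)+
  then show ?thesis unfolding bc_inner_def by measurable
qed

lemma norm_bc_inner_le: "cmod (bc_inner W V) \<le> (norm W)\<^sup>2 + (norm V)\<^sup>2"
proof -
  have "cmod (bc_inner W V) \<le> cmod (Sc W) * cmod (Sc V) + cmod (Vec W) * cmod (Vec V)"
    unfolding bc_inner_def by (rule norm_triangle_le) (simp add: norm_mult)
  also have "\<dots> \<le> (norm W)\<^sup>2 + (norm V)\<^sup>2"
  proof -
    have "x * y \<le> x\<^sup>2 + y\<^sup>2" if "0 \<le> x" "0 \<le> y" for x y :: real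
      using sum_squares_bound[of x y] mult_nonneg_nonneg[OF that] by linarith
    from this[of "cmod (Sc W)" "cmod (Sc V)"] this[of "cmod (Vec W)" "cmod (Vec V)"]
    show ?thesis by (simp add: norm_bicomplex_def)
  qed
  finally show ?thesis .
qed

section \<open>Closed subspaces of \<open>L\<^sub>p\<close>\<close>

text \<open>\<open>S\<close> is a set of functions, not of classes. Closedness, applied to constant
  sequences, makes it contain every measurable function that equals one of its members almost
  everywhere.\<close>

locale closed_bc_Lp_subspace =
  fixes p :: ennreal and \<Omega> :: "complex set" and S :: "(complex \<Rightarrow> bicomplex) set"
  assumes p: "1 < p"
    and \<Omega>: "bounded \<Omega>" "\<Omega> \<in> sets lebesgue"
    and S_Lp: "S \<subseteq> Lp_fun p (lebesgue_on \<Omega>)"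
    and S_zero: "(\<lambda>z. 0) \<in> S"
    and S_add: "F \<in> S \<Longrightarrow> G \<in> S \<Longrightarrow> (\<lambda>z. F z + G z) \<in> S"
    and S_scale: "F \<in> S \<Longrightarrow> (\<lambda>z. bc_of_complex c * F z) \<in> S"
    and S_closed: "\<lbrakk>\<And>n. Fn n \<in> S; G \<in> Lp_fun p (lebesgue_on \<Omega>);
      (\<lambda>n. Lp_norm p (lebesgue_on \<Omega>) (\<lambda>z. Fn n z - G z)) \<longlonglongrightarrow> 0\<rbrakk> \<Longrightarrow> G \<in> S"
begin

abbreviation M :: "complex measure" where "M \<equiv> lebesgue_on \<Omega>"

abbreviation cls :: "(complex \<Rightarrow> bicomplex) \<Rightarrow> (complex \<Rightarrow> bicomplex) set" where "cls \<equiv> ae_class M"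

definition X :: "(complex \<Rightarrow> bicomplex) set cnspace" where
  "X = (bc_Lp p \<Omega>)\<lparr>ns_carrier := cls ` S\<rparr>"

lemma finite_measure_M: "finite_measure M"
  using \<Omega> bounded_set_imp_lmeasurable finite_measure_lebesgue_on by blast

lemma S_LpD: "F \<in> S \<Longrightarrow> F \<in> Lp_fun p M"
  using S_Lp by blast

lemma S_measurable: "F \<in> S \<Longrightarrow> F \<in> borel_measurable M"
  using S_LpD Lp_fun_measurable by blast

lemma S_diff: "F \<in> S \<Longrightarrow> G \<in> S \<Longrightarrow> (\<lambda>z. F z - G z) \<in> S"
  using S_add[OF _ S_scale[of G "- 1"]] by simp

lemma carrier_X: "ns_carrier X = cls ` S"
  by (simp add: X_def)

lemma zero_X: "ns_zero X = cls (\<lambda>z. 0)"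
  by (simp add: X_def bc_Lp_def)

lemma add_X: "F \<in> S \<Longrightarrow> G \<in> S \<Longrightarrow> ns_add X (cls F) (cls G) = cls (\<lambda>z. F z + G z)"
  using bc_Lp_ae_class(1)[of F \<Omega> G p] by (simp add: X_def S_measurable)

lemma scale_X: "F \<in> S \<Longrightarrow> ns_scale X c (cls F) = cls (\<lambda>z. bc_of_complex c * F z)"
  using bc_Lp_ae_class(2)[of F \<Omega> F p c] by (simp add: X_def S_measurable)

lemma norm_X: "F \<in> S \<Longrightarrow> ns_norm X (cls F) = Lp_norm p M F"
  using bc_Lp_ae_class(3)[of F \<Omega> F p] by (simp add: X_def S_measurable)

lemma dist_X: "F \<in> S \<Longrightarrow> G \<in> S \<Longrightarrow> ns_dist X (cls F) (cls G) = Lp_norm p M (\<lambda>z. F z - G z)"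
  using S_scale[of G "- 1"] S_diff[of F G]
  by (simp add: ns_dist_def carrier_X scale_X add_X norm_X)

lemmas X_simps = carrier_X zero_X add_X scale_X norm_X S_zero S_add S_scale

sublocale complex_vector_space X
proof
  fix x y z c d
  assume "x \<in> ns_carrier X"
  then obtain F where F: "F \<in> S" "x = cls F" by (auto simp: carrier_X)
  show "ns_scale X c x \<in> ns_carrier X" using F by (simp add: X_simps)
  show "ns_add X x (ns_zero X) = x" using F by (simp add: X_simps)
  show "ns_scale X (c + d) x = ns_add X (ns_scale X c x) (ns_scale X d x)"
    using F by (simp add: X_simps bc_of_complex_add distrib_right)
  show "ns_scale X c (ns_scale X d x) = ns_scale X (c * d) x"
    using F by (simp add: X_simps bc_of_complex_mult mult.assoc)
  show "ns_scale X 1 x = x" using F by (simp add: X_simps)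
  have "ns_add X x (cls (\<lambda>z. bc_of_complex (- 1) * F z)) = ns_zero X"
    unfolding F(2) by (subst add_X[OF F(1) S_scale[OF F(1)]]) (simp add: zero_X)
  then show "\<exists>y\<in>ns_carrier X. ns_add X x y = ns_zero X"
    using S_scale[OF F(1)] unfolding carrier_X by blast
  assume "y \<in> ns_carrier X"
  then obtain G where G: "G \<in> S" "y = cls G" by (auto simp: carrier_X)
  show "ns_add X x y \<in> ns_carrier X" using F G by (simp add: X_simps)
  show "ns_add X x y = ns_add X y x" using F G by (simp add: X_simps add.commute)
  show "ns_scale X c (ns_add X x y) = ns_add X (ns_scale X c x) (ns_scale X c y)"
    using F G by (simp add: X_simps distrib_left)
  assume "z \<in> ns_carrier X"
  then obtain H where H: "H \<in> S" "z = cls H" by (auto simp: carrier_X)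
  show "ns_add X (ns_add X x y) z = ns_add X x (ns_add X y z)"
    using F G H by (simp add: X_simps add.assoc)
qed (simp add: X_simps)

sublocale complex_normed_space X
proof
  fix x y c
  assume "x \<in> ns_carrier X"
  then obtain F where F: "F \<in> S" "x = cls F" by (auto simp: carrier_X)
  show "0 \<le> ns_norm X x" using F by (simp add: X_simps Lp_norm_nonneg)
  show "ns_norm X x = 0 \<longleftrightarrow> x = ns_zero X"
    using F by (simp add: X_simps Lp_norm_eq_0_iff[OF p S_LpD] ae_class_eq_iff S_measurable)
  show "ns_norm X (ns_scale X c x) = cmod c * ns_norm X x"
    using F by (simp add: X_simps Lp_bc_scale[OF p S_LpD])
  assume "y \<in> ns_carrier X"
  then obtain G where G: "G \<in> S" "y = cls G" by (auto simp: carrier_X)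
  show "ns_norm X (ns_add X x y) \<le> ns_norm X x + ns_norm X y"
    using F G Lp_Minkowski(2)[OF p S_LpD S_LpD] by (simp add: X_simps)
qed

lemma mcomplete_X: "metric.mcomplete"
  unfolding metric.mcomplete_def
proof (intro allI impI)
  fix \<sigma> assume \<sigma>: "metric.MCauchy \<sigma>"
  then have "range \<sigma> \<subseteq> cls ` S" unfolding metric.MCauchy_def by (simp flip: carrier_X)
  then have "\<forall>n. \<exists>F. F \<in> S \<and> \<sigma> n = cls F" by blast
  then obtain F where F: "\<And>n. F n \<in> S" "\<And>n. \<sigma> n = cls (F n)" by metis
  have "\<exists>N. \<forall>m\<ge>N. \<forall>n\<ge>N. Lp_norm p M (\<lambda>z. F m z - F n z) < e" if "0 < e" for e
  proof -
    have "\<exists>N. \<forall>m n. N \<le> m \<longrightarrow> N \<le> n \<longrightarrow> ns_dist X (\<sigma> m) (\<sigma> n) < e"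
      using \<sigma> that unfolding metric.MCauchy_def by blast
    then show ?thesis unfolding F(2) dist_X[OF F(1) F(1)] by blast
  qed
  from Lp_complete[of M p F, OF finite_measure_M p S_LpD[OF F(1)] this]
  obtain G where G: "G \<in> Lp_fun p M" "(\<lambda>n. Lp_norm p M (\<lambda>z. F n z - G z)) \<longlonglongrightarrow> 0"
    by blast
  then have "G \<in> S" using S_closed F(1) by blast
  then have "limitin metric.mtopology \<sigma> (cls G) sequentially"
    unfolding metric.limitin_metric_dist_null using G F by (simp add: dist_X) (simp add: carrier_X)
  then show "\<exists>x. limitin metric.mtopology \<sigma> x sequentially" by blast
qed

lemma banach_X: "complex_banach_space X"
  unfolding complex_banach_space_def using mcomplete_X complex_normed_space_axioms by blast

lemma reflexive_X:
  assumes "p < \<infinity>"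
  shows "ns_reflexive X"
proof (rule Milman_Pettis[OF mcomplete_X])
  fix e :: real assume "0 < e"
  from Lp_uniformly_convex[OF p assms this, of M, where 'b=bicomplex]
  obtain d where d: "0 < d"
    "\<And>F G. F \<in> Lp_fun p M \<Longrightarrow> G \<in> Lp_fun p M \<Longrightarrow> Lp_norm p M F \<le> 1 \<Longrightarrow> Lp_norm p M G \<le> 1
      \<Longrightarrow> 2 - d \<le> Lp_norm p M (\<lambda>z. F z + G z) \<Longrightarrow> Lp_norm p M (\<lambda>z. F z - G z :: bicomplex) \<le> e"
    by blast
  show "\<exists>d>0. \<forall>x\<in>ns_ball. \<forall>y\<in>ns_ball. 2 - d \<le> ns_norm X (ns_add X x y) \<longrightarrow> ns_dist X x y \<le> e"
  proof (intro exI[of _ d] conjI ballI impI d(1))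
    fix x y assume xy: "x \<in> ns_ball" "y \<in> ns_ball" "2 - d \<le> ns_norm X (ns_add X x y)"
    then obtain F G where F: "F \<in> S" "x = cls F" and G: "G \<in> S" "y = cls G"
      by (auto simp: ns_ball_def carrier_X)
    have "Lp_norm p M F \<le> 1" "Lp_norm p M G \<le> 1" "2 - d \<le> Lp_norm p M (\<lambda>z. F z + G z)"
      using xy F G by (auto simp: ns_ball_def norm_X add_X S_add)
    then show "ns_dist X x y \<le> e" using d(2)[OF S_LpD S_LpD] F G by (simp add: dist_X)
  qed
qed

text \<open>The countable dense set of L_p need not meet \<open>S\<close>. For each of its members
  \<open>d\<close> and each radius 1/(n+1), one element of \<open>S\<close> within that radius of
  \<open>d\<close> is chosen if there is one; these choices are dense in \<open>S\<close>.\<close>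

lemma separable_X:
  assumes "p < \<infinity>"
  shows "ns_separable X"
proof -
  obtain D :: "(complex \<Rightarrow> bicomplex) set" where D: "countable D" "D \<subseteq> Lp_fun p M"
    "\<And>F e. F \<in> Lp_fun p M \<Longrightarrow> 0 < e \<Longrightarrow> \<exists>d\<in>D. Lp_norm p M (\<lambda>z. F z - d z) < e"
    using Lp_separable[OF p assms \<Omega>, where 'b=bicomplex] by metis
  define near where "near d n F \<longleftrightarrow> F \<in> S \<and> Lp_norm p M (\<lambda>z. F z - d z) < inverse (real (Suc n))" for d n F
  define C where "C = (\<lambda>(d, n). cls (SOME F. near d n F)) ` {(d, n). d \<in> D \<and> (\<exists>F. near d n F)}"
  have "{(d, n :: nat). d \<in> D \<and> (\<exists>F. near d n F)} \<subseteq> D \<times> UNIV" by auto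
  then have "countable C"
    unfolding C_def using D(1) by (intro countable_image) (rule countable_subset, auto)
  moreover have "C \<subseteq> ns_carrier X"
  proof -
    have "(SOME F. near d n F) \<in> S" if "\<exists>F. near d n F" for d n
      using someI_ex[OF that] by (simp add: near_def)
    then show ?thesis unfolding C_def carrier_X by (auto intro: imageI)
  qed
  moreover have "metric.mtopology closure_of C = ns_carrier X"
    unfolding metric.metric_closure_of
  proof (intro equalityI subsetI CollectI conjI allI impI)
    fix x and r :: real assume x: "x \<in> ns_carrier X" and r: "0 < r"
    then obtain F where F: "F \<in> S" "x = cls F" by (auto simp: carrier_X)
    obtain n where n: "inverse (real (Suc n)) < r / 2" using reals_Archimedean[of "r / 2"] r by auto
    obtain d where d: "d \<in> D" "Lp_norm p M (\<lambda>z. F z - d z) < inverse (real (Suc n))"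
      using D(3)[OF S_LpD[OF F(1)], of "inverse (real (Suc n))"] by auto
    define G where "G = (SOME F. near d n F)"
    have "near d n F" using F d by (simp add: near_def)
    then have G: "near d n G" unfolding G_def by (rule someI[of "near d n"])
    then have GS: "G \<in> S" by (simp add: near_def)
    have "Lp_norm p M (\<lambda>z. F z - G z) \<le> Lp_norm p M (\<lambda>z. F z - d z) + Lp_norm p M (\<lambda>z. d z - G z)"
      using F GS d D(2) by (intro Lp_norm_diff_triangle p) (auto intro: S_LpD)
    also have "\<dots> < r"
      using d(2) G n unfolding near_def by (simp add: Lp_norm_diff_commute[of p M d G])
    finally have "cls G \<in> metric.mball x r"
      using F GS by (simp add: metric.in_mball dist_X) (simp add: carrier_X)
    moreover have "cls G \<in> C"
      unfolding C_def G_def using d(1) \<open>near d n F\<close> by (intro image_eqI[of _ _ "(d, n)"]) auto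
    ultimately show "\<exists>y\<in>C. y \<in> metric.mball x r" by blast
  qed simp
  ultimately show ?thesis
    unfolding ns_separable_def separable_space_def by auto
qed

end

section \<open>The inner product for p = 2\<close>

lemma Lp_fun_2_iff: "F \<in> Lp_fun 2 M \<longleftrightarrow> F \<in> borel_measurable M \<and> integrable M (\<lambda>x. (norm (F x))\<^sup>2)"
  by (simp add: Lp_fun_def)

lemma Lp_norm_2: "Lp_norm 2 M F = sqrt (LINT x|M. (norm (F x))\<^sup>2)"
  by (simp add: Lp_norm_def powr_half_sqrt)

lemma integrable_bc_inner:
  assumes "F \<in> Lp_fun 2 M" "G \<in> Lp_fun 2 M"
  shows "integrable M (\<lambda>z. bc_inner (F z) (G z))"
proof (rule Bochner_Integration.integrable_bound)
  have [measurable]: "F \<in> borel_measurable M" "G \<in> borel_measurable M"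
    using assms by (auto simp: Lp_fun_2_iff)
  show "integrable M (\<lambda>z. (norm (F z))\<^sup>2 + (norm (G z))\<^sup>2)" using assms by (simp add: Lp_fun_2_iff)
  show "(\<lambda>z. bc_inner (F z) (G z)) \<in> borel_measurable M" by measurable
  show "AE z in M. norm (bc_inner (F z) (G z)) \<le> norm ((norm (F z))\<^sup>2 + (norm (G z))\<^sup>2)"
    using norm_bc_inner_le by (intro AE_I2) simp
qed

text \<open>Chosen representatives agree almost everywhere with the given functions, so the axioms
  reduce to pointwise identities for \<open>bc_inner\<close>. Definiteness is inherited from the
  norm through \<open>self\<close>.\<close>

lemma hilbert_closed_bc_Lp_subspace:
  assumes "closed_bc_Lp_subspace 2 \<Omega> S"
  shows "complex_hilbert_space (closed_bc_Lp_subspace.X 2 \<Omega> S) (bc_L2_inner \<Omega>)"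
proof -
  interpret closed_bc_Lp_subspace 2 \<Omega> S by fact
  have ip: "bc_L2_inner \<Omega> (cls F) (cls G) = (LINT z|M. bc_inner (F z) (G z))" if "F \<in> S" "G \<in> S" for F G
    unfolding bc_L2_inner_def
  proof (rule integral_cong_AE)
    note [measurable] = that[THEN S_measurable] that[THEN S_measurable, THEN ae_rep_ae_class(1)]
    show "(\<lambda>z. bc_inner (ae_rep (cls F) z) (ae_rep (cls G) z)) \<in> borel_measurable M"
      "(\<lambda>z. bc_inner (F z) (G z)) \<in> borel_measurable M" by measurable
    show "AE z in M. bc_inner (ae_rep (cls F) z) (ae_rep (cls G) z) = bc_inner (F z) (G z)"
      using that[THEN S_measurable, THEN ae_rep_ae_class(2)] by eventually_elim simp
  qed
  have self: "bc_L2_inner \<Omega> (cls F) (cls F) = of_real ((Lp_norm 2 M F)\<^sup>2)" if "F \<in> S" for F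
    using that by (simp add: ip bc_inner_self Lp_norm_2 del: of_real_power)
  have int: "integrable M (\<lambda>z. bc_inner (F z) (G z))" if "F \<in> S" "G \<in> S" for F G
    using that by (intro integrable_bc_inner S_LpD)
  have "complex_inner_product X (bc_L2_inner \<Omega>)"
  proof
    fix x y z c
    assume "x \<in> ns_carrier X"
    then obtain F where F: "F \<in> S" "x = cls F" by (auto simp: carrier_X)
    show "0 \<le> Re (bc_L2_inner \<Omega> x x)" using F by (simp add: self del: of_real_power)
    show "bc_L2_inner \<Omega> x x = 0 \<longleftrightarrow> x = ns_zero X"
      using F norm_eq_zero[of x] by (simp add: self norm_X carrier_X del: of_real_power)
    assume "y \<in> ns_carrier X"
    then obtain G where G: "G \<in> S" "y = cls G" by (auto simp: carrier_X)
    show "bc_L2_inner \<Omega> (ns_scale X c x) y = c * bc_L2_inner \<Omega> x y"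
    proof -
      have "bc_inner (bc_of_complex c * F z) (G z) = c * bc_inner (F z) (G z)" for z
        by (simp add: bc_inner_def algebra_simps)
      then show ?thesis using F G by (simp add: scale_X ip S_scale)
    qed
    show "bc_L2_inner \<Omega> x y = cnj (bc_L2_inner \<Omega> y x)"
    proof -
      have "bc_inner (F z) (G z) = cnj (bc_inner (G z) (F z))" for z
        by (simp add: bc_inner_def mult.commute)
      then show ?thesis using F G by (simp add: ip)
    qed
    assume "z \<in> ns_carrier X"
    then obtain H where H: "H \<in> S" "z = cls H" by (auto simp: carrier_X)
    show "bc_L2_inner \<Omega> (ns_add X x y) z = bc_L2_inner \<Omega> x z + bc_L2_inner \<Omega> y z"
    proof -
      have "bc_inner (F w + G w) (H w) = bc_inner (F w) (H w) + bc_inner (G w) (H w)" for w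
        by (simp add: bc_inner_def algebra_simps)
      then show ?thesis using F G H by (simp add: add_X ip S_add int)
    qed
  qed
  moreover have "\<forall>x\<in>ns_carrier X. ns_norm X x = sqrt (Re (bc_L2_inner \<Omega> x x))"
    by (auto simp: carrier_X norm_X self Lp_norm_nonneg simp del: of_real_power)
  ultimately show ?thesis
    unfolding complex_hilbert_space_def using banach_X by blast
qed

section \<open>The Vekua equation\<close>

lemma bounded_continuous_image:
  fixes h :: "complex \<Rightarrow> 'b::real_normed_vector"
  assumes "bounded \<Omega>" "continuous_on UNIV h"
  obtains B where "0 \<le> B" "\<And>z. z \<in> \<Omega> \<Longrightarrow> norm (h z) \<le> B"
proof -
  have "compact (h ` closure \<Omega>)"
    using assms by (intro compact_continuous_image) (auto intro: continuous_on_subset simp: compact_closure)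
  then obtain B where B: "\<And>y. y \<in> h ` closure \<Omega> \<Longrightarrow> norm y \<le> B" using compact_imp_bounded bounded_iff by metis
  have "norm (h z) \<le> \<bar>B\<bar>" if "z \<in> \<Omega>" for z
    using B[of "h z"] that closure_subset[of \<Omega>] by force
  then show ?thesis using that[of "\<bar>B\<bar>"] by simp
qed

text \<open>Smoothness of test functions is stated for the two components. Their derivatives are
  carried over through \<open>J\<close>, which reassembles a bicomplex number from its components by
  bounded linear maps.\<close>

lemma test_function_continuous:
  assumes "\<phi> \<in> bc_valued (C0_infinity \<Omega>)"
  shows "continuous_on UNIV \<phi>" "continuous_on UNIV (bc_dbar \<phi>)"
proof -
  define u where "u z = Sc (\<phi> z)" for z
  define v where "v z = Vec (\<phi> z)" for z
  have C: "C_k 0 u" "C_k 0 v" "C_k (Suc 0) u" "C_k (Suc 0) v"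
    using assms by (auto simp: bc_valued_def C0_infinity_def u_def[abs_def] v_def[abs_def])
  define J where "J s t = bc_of_complex s + bc_j * bc_of_complex t" for s t
  have \<phi>: "\<phi> z = J (u z) (v z)" for z by (simp add: J_def u_def v_def bicomplex_decompose[symmetric])
  have J_cont: "continuous_on UNIV (\<lambda>z :: complex. J (f z) (g z))"
    if "continuous_on UNIV f" "continuous_on UNIV g" for f g
    unfolding J_def
    by (intro continuous_on_add continuous_on_bc_mult continuous_on_const
        bounded_linear.continuous_on[OF bounded_linear_bc_of_complex] that)
  have J_deriv: "((\<lambda>t. J (f t) (g t)) has_vector_derivative J f' g') (at s)"
    if "(f has_vector_derivative f') (at s)" "(g has_vector_derivative g') (at s)" for f g f' g' and s :: real
    unfolding J_def
    by (intro has_vector_derivative_add that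
        bounded_linear.has_vector_derivative[OF bounded_linear_bc_of_complex]
        bounded_linear.has_vector_derivative[OF bounded_bilinear.bounded_linear_right[OF bounded_bilinear_bc_mult]])
  show "continuous_on UNIV \<phi>" using J_cont[of u v] C by (simp add: \<phi>)
  have "partial_x \<phi> z = J (partial_x u z) (partial_x v z)" for z
    unfolding partial_x_def \<phi>
    using C by (intro vector_derivative_at J_deriv) (auto simp: vector_derivative_works)
  moreover have "partial_y \<phi> z = J (partial_y u z) (partial_y v z)" for z
    unfolding partial_y_def \<phi>
    using C by (intro vector_derivative_at J_deriv) (auto simp: vector_derivative_works)
  ultimately have "bc_dbar \<phi> = (\<lambda>z. (1 / 2) *\<^sub>R (J (partial_x u z) (partial_x v z) + bc_j * J (partial_y u z) (partial_y v z)))"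
    by (simp add: fun_eq_iff bc_dbar_def)
  then show "continuous_on UNIV (bc_dbar \<phi>)"
    using C J_cont by (auto intro!: continuous_on_scaleR continuous_on_add continuous_on_bc_mult continuous_on_const)
qed

lemma integrable_bc_mult_bounded:
  fixes F G :: "'a \<Rightarrow> bicomplex"
  assumes "integrable M F" and [measurable]: "G \<in> borel_measurable M" and "AE z in M. norm (G z) \<le> B"
  shows "integrable M (\<lambda>z. F z * G z)" "(LINT z|M. norm (F z * G z)) \<le> 4 * B * (LINT z|M. norm (F z))"
proof -
  have [measurable]: "F \<in> borel_measurable M" using assms(1) by auto
  have le: "AE z in M. norm (F z * G z) \<le> 4 * B * norm (F z)"
    using assms(3)
  proof eventually_elim
    case (elim z)
    have "norm (F z * G z) \<le> 4 * (norm (F z) * norm (G z))" by (rule norm_bc_mult_le)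
    also have "\<dots> \<le> 4 * (norm (F z) * B)" using elim by (intro mult_left_mono) auto
    finally show ?case by (simp add: mult_ac)
  qed
  have int: "integrable M (\<lambda>z. 4 * B * norm (F z))" using assms(1) by simp
  show 1: "integrable M (\<lambda>z. F z * G z)"
    using le by (intro Bochner_Integration.integrable_bound[OF int]) (auto elim!: eventually_mono)
  have "(LINT z|M. norm (F z * G z)) \<le> (LINT z|M. 4 * B * norm (F z))"
    using 1 int le by (intro integral_mono_AE) auto
  then show "(LINT z|M. norm (F z * G z)) \<le> 4 * B * (LINT z|M. norm (F z))" by simp
qed

locale vekua =
  fixes \<Omega> :: "complex set" and a b :: "complex \<Rightarrow> bicomplex"
  assumes \<Omega>: "bounded \<Omega>" "\<Omega> \<in> sets lebesgue"
    and a: "a \<in> Lp_fun \<infinity> (lebesgue_on \<Omega>)" and b: "b \<in> Lp_fun \<infinity> (lebesgue_on \<Omega>)"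
begin

abbreviation M :: "complex measure" where "M \<equiv> lebesgue_on \<Omega>"

definition rhs :: "(complex \<Rightarrow> bicomplex) \<Rightarrow> complex \<Rightarrow> bicomplex" where
  "rhs W z = a z * W z + b z * bc_cnj (W z)"

text \<open>Both sides of the weak equation collected in a single integral, for a fixed test
  function.\<close>

definition defect :: "(complex \<Rightarrow> bicomplex) \<Rightarrow> (complex \<Rightarrow> bicomplex) \<Rightarrow> bicomplex" where
  "defect \<phi> W = (LINT z|M. W z * bc_dbar \<phi> z + rhs W z * \<phi> z)"

lemma rhs_L1:
  assumes W: "integrable M W"
  shows "integrable M (rhs W)"
    "(LINT z|M. norm (rhs W z)) \<le> 4 * (Lp_norm \<infinity> M a + Lp_norm \<infinity> M b) * (LINT z|M. norm (W z))"
proof -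
  have [measurable]: "W \<in> borel_measurable M" using W by auto
  have cW: "integrable M (\<lambda>z. bc_cnj (W z))"
    by (rule Bochner_Integration.integrable_bound[OF W]) (auto simp: norm_bc_cnj)
  note A = integrable_bc_mult_bounded[OF W Lp_fun_measurable[OF a] Lp_norm_infinity_AE[OF a]]
  note B = integrable_bc_mult_bounded[OF cW Lp_fun_measurable[OF b] Lp_norm_infinity_AE[OF b]]
  have eq: "rhs W = (\<lambda>z. W z * a z + bc_cnj (W z) * b z)" by (simp add: fun_eq_iff rhs_def mult.commute)
  show int: "integrable M (rhs W)" unfolding eq by (intro Bochner_Integration.integrable_add A B)
  have "(LINT z|M. norm (rhs W z)) \<le> (LINT z|M. norm (W z * a z) + norm (bc_cnj (W z) * b z))"
    using int A B by (intro integral_mono) (auto simp: eq norm_triangle_ineq)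
  also have "\<dots> \<le> 4 * (Lp_norm \<infinity> M a + Lp_norm \<infinity> M b) * (LINT z|M. norm (W z))"
    using A B by (simp add: norm_bc_cnj algebra_simps)
  finally show "(LINT z|M. norm (rhs W z)) \<le> 4 * (Lp_norm \<infinity> M a + Lp_norm \<infinity> M b) * (LINT z|M. norm (W z))" .
qed

lemma AE_norm_continuous_le:
  fixes h :: "complex \<Rightarrow> bicomplex"
  assumes "continuous_on UNIV h"
  obtains B where "0 \<le> B" "AE z in M. norm (h z) \<le> B" "h \<in> borel_measurable M"
proof -
  obtain B where B: "0 \<le> B" "\<And>z. z \<in> \<Omega> \<Longrightarrow> norm (h z) \<le> B"
    using bounded_continuous_image[OF \<Omega>(1) assms] by blast
  have "AE z in M. norm (h z) \<le> B" using B(2) AE_space[of M] by (auto elim!: eventually_mono)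
  moreover have "h \<in> borel_measurable M"
    by (intro borel_measurable_lebesgue_onI borel_measurable_continuous_onI assms)
  ultimately show ?thesis using that B(1) by blast
qed

text \<open>The constant depends on the test function but not on \<open>W\<close>; this uniformity
  makes the zero set of \<open>defect \<phi>\<close> closed.\<close>

lemma defect_L1:
  assumes \<phi>: "\<phi> \<in> bc_valued (C0_infinity \<Omega>)"
  obtains C where "0 \<le> C"
    "\<And>W. integrable M W \<Longrightarrow> integrable M (\<lambda>z. W z * bc_dbar \<phi> z) \<and> integrable M (\<lambda>z. rhs W z * \<phi> z) \<and>
      norm (defect \<phi> W) \<le> C * (LINT z|M. norm (W z))"
proof -
  obtain B1 where B1: "0 \<le> B1" "AE z in M. norm (bc_dbar \<phi> z) \<le> B1" "bc_dbar \<phi> \<in> borel_measurable M"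
    using AE_norm_continuous_le[OF test_function_continuous(2)[OF \<phi>]] by blast
  obtain B2 where B2: "0 \<le> B2" "AE z in M. norm (\<phi> z) \<le> B2" "\<phi> \<in> borel_measurable M"
    using AE_norm_continuous_le[OF test_function_continuous(1)[OF \<phi>]] by blast
  define K where "K = 4 * (Lp_norm \<infinity> M a + Lp_norm \<infinity> M b)"
  have K: "0 \<le> K" by (simp add: K_def Lp_norm_nonneg)
  have "integrable M (\<lambda>z. W z * bc_dbar \<phi> z) \<and> integrable M (\<lambda>z. rhs W z * \<phi> z) \<and>
      norm (defect \<phi> W) \<le> (4 * B1 + 4 * B2 * K) * (LINT z|M. norm (W z))" if W: "integrable M W" for W
  proof -
    note 1 = integrable_bc_mult_bounded[OF W B1(3,2)]
    note 2 = integrable_bc_mult_bounded[OF rhs_L1(1)[OF W] B2(3,2)]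
    have "norm (defect \<phi> W) \<le> (LINT z|M. norm (W z * bc_dbar \<phi> z + rhs W z * \<phi> z))"
      unfolding defect_def by (rule integral_norm_bound)
    also have "\<dots> \<le> (LINT z|M. norm (W z * bc_dbar \<phi> z) + norm (rhs W z * \<phi> z))"
      using 1(1) 2(1) by (intro integral_mono) (auto simp: norm_triangle_ineq)
    also have "\<dots> = (LINT z|M. norm (W z * bc_dbar \<phi> z)) + (LINT z|M. norm (rhs W z * \<phi> z))"
      using 1(1) 2(1) by simp
    also have "\<dots> \<le> 4 * B1 * (LINT z|M. norm (W z)) + 4 * B2 * (K * (LINT z|M. norm (W z)))"
    proof (intro add_mono 1(2) order_trans[OF 2(2)] mult_left_mono)
      show "(LINT z|M. norm (rhs W z)) \<le> K * (LINT z|M. norm (W z))" using rhs_L1(2)[OF W] by (simp add: K_def)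
    qed (use B2 in simp)
    finally show ?thesis using 1(1) 2(1) by (simp add: algebra_simps)
  qed
  moreover have "0 \<le> 4 * B1 + 4 * B2 * K" using B1 B2 K by simp
  ultimately show ?thesis using that by blast
qed

text \<open>Settles the local integrability that \<open>is_weak_bc_dbar\<close> demands of the
  right-hand side.\<close>

lemma integrable_imp_L1_loc:
  assumes V: "integrable M V"
  shows "V \<in> bc_valued (L1_loc \<Omega>)"
proof -
  have "f \<in> L1_loc \<Omega>" if f: "integrable M f" for f :: "complex \<Rightarrow> complex"
    unfolding L1_loc_def
  proof (intro CollectI allI impI)
    fix K assume K: "compact K \<and> K \<subseteq> \<Omega>"
    then have K': "K \<in> sets lebesgue" using lmeasurable_compact fmeasurableD by blast
    have "set_integrable lebesgue \<Omega> f"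
      using f \<Omega>(2) by (simp add: set_integrable_def integrable_restrict_space)
    then have "set_integrable lebesgue K f"
      by (rule set_integrable_subset) (use K K' in auto)
    then show "integrable (lebesgue_on K) f"
      using K' by (simp add: set_integrable_def integrable_restrict_space)
  qed
  then show ?thesis
    unfolding bc_valued_def
    using integrable_bounded_linear[OF bounded_linear_Sc V] integrable_bounded_linear[OF bounded_linear_Vec V] by blast
qed

text \<open>On a set of finite measure a function in L_p is integrable, hence both integrals of the
  weak equation exist and may be merged into \<open>defect\<close>.\<close>

lemma vekua_bergman_functions_eq:
  assumes p: "1 < p"
  shows "vekua_bergman_functions p a b \<Omega>
    = {W \<in> Lp_fun p M. \<forall>\<phi>\<in>bc_valued (C0_infinity \<Omega>). defect \<phi> W = 0}"
proof -
  have "is_weak_bc_dbar \<Omega> W (rhs W) \<longleftrightarrow> (\<forall>\<phi>\<in>bc_valued (C0_infinity \<Omega>). defect \<phi> W = 0)"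
    if W: "W \<in> Lp_fun p M" for W
  proof -
    have "finite_measure M" using \<Omega> bounded_set_imp_lmeasurable finite_measure_lebesgue_on by blast
    then have int: "integrable M W" using Lp_imp_L1(1)[OF _ p W] by blast
    have "(LINT z|M. W z * bc_dbar \<phi> z) = - (LINT z|M. rhs W z * \<phi> z) \<longleftrightarrow> defect \<phi> W = 0"
      if "\<phi> \<in> bc_valued (C0_infinity \<Omega>)" for \<phi>
    proof -
      have "integrable M (\<lambda>z. W z * bc_dbar \<phi> z)" "integrable M (\<lambda>z. rhs W z * \<phi> z)"
        using defect_L1[OF that] int by metis+
      then show ?thesis by (simp add: defect_def eq_neg_iff_add_eq_0)
    qed
    then show ?thesis
      unfolding is_weak_bc_dbar_def using integrable_imp_L1_loc[OF rhs_L1(1)[OF int]] by blast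
  qed
  then show ?thesis
    unfolding vekua_bergman_functions_def bc_valued_Lp_fun[OF p] rhs_def[abs_def] by blast
qed

lemma closed_subspace:
  assumes p: "1 < p"
  shows "closed_bc_Lp_subspace p \<Omega> (vekua_bergman_functions p a b \<Omega>)"
proof -
  have fin: "finite_measure M" using \<Omega> bounded_set_imp_lmeasurable finite_measure_lebesgue_on by blast
  note L1 = Lp_imp_L1[OF fin p]
  have int: "integrable M (\<lambda>z. W z * bc_dbar \<phi> z)" "integrable M (\<lambda>z. rhs W z * \<phi> z)"
    if "\<phi> \<in> bc_valued (C0_infinity \<Omega>)" "W \<in> Lp_fun p M" for \<phi> W
    using defect_L1[OF that(1)] L1(1)[OF that(2)] by metis+
  have defect_add: "defect \<phi> (\<lambda>z. F z + G z) = defect \<phi> F + defect \<phi> G"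
    if "\<phi> \<in> bc_valued (C0_infinity \<Omega>)" "F \<in> Lp_fun p M" "G \<in> Lp_fun p M" for \<phi> F G
  proof -
    have "(F z + G z) * bc_dbar \<phi> z + rhs (\<lambda>z. F z + G z) z * \<phi> z
      = (F z * bc_dbar \<phi> z + rhs F z * \<phi> z) + (G z * bc_dbar \<phi> z + rhs G z * \<phi> z)" for z
      by (simp add: rhs_def linear_add[OF bounded_linear.linear[OF bounded_linear_bc_cnj]] algebra_simps)
    then show ?thesis using int[OF that(1,2)] int[OF that(1,3)] by (simp add: defect_def)
  qed
  have defect_scale: "defect \<phi> (\<lambda>z. bc_of_complex c * F z) = bc_of_complex c * defect \<phi> F"
    if "\<phi> \<in> bc_valued (C0_infinity \<Omega>)" "F \<in> Lp_fun p M" for \<phi> F c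
  proof -
    \<comment> \<open>Conjugation in j fixes complex scalars; for the factor j the sign would
      change. This is why the space is complex-linear.\<close>
    have cnj: "bc_cnj (bc_of_complex c * W) = bc_of_complex c * bc_cnj W" for W
      by (simp add: bicomplex_eq_iff)
    have "bc_of_complex c * F z * bc_dbar \<phi> z + rhs (\<lambda>z. bc_of_complex c * F z) z * \<phi> z
      = bc_of_complex c * (F z * bc_dbar \<phi> z + rhs F z * \<phi> z)" for z
      by (simp add: rhs_def cnj algebra_simps)
    then show ?thesis
      using int[OF that]
        integral_bounded_linear[OF bounded_bilinear.bounded_linear_right[OF bounded_bilinear_bc_mult, of "bc_of_complex c"],
          of M "\<lambda>z. F z * bc_dbar \<phi> z + rhs F z * \<phi> z"]
      by (simp add: defect_def)
  qed
  show ?thesis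
    unfolding vekua_bergman_functions_eq[OF p]
  \<comment> \<open>Goals 5 to 8 are the zero function, sums, complex multiples and closedness. The
    first four restate the conditions on \<open>p\<close> and \<open>\<Omega>\<close> and the
    inclusion in L_p.\<close>
  proof (unfold_locales, goal_cases)
    case 5
    then show ?case using Lp_zero(1)[OF p] linear_0[OF bounded_linear.linear[OF bounded_linear_bc_cnj]]
      by (simp add: defect_def rhs_def)
  next
    case (6 F G)
    then show ?case by (simp add: Lp_Minkowski(1)[OF p] defect_add)
  next
    case (7 F c)
    then show ?case by (simp add: Lp_bc_scale(1)[OF p] defect_scale)
  next
    case (8 F G)
    have FLp: "F n \<in> Lp_fun p M" for n using 8(1)[of n] by simp
    have "defect \<phi> G = 0" if \<phi>: "\<phi> \<in> bc_valued (C0_infinity \<Omega>)" for \<phi>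
    proof -
      obtain C where C: "0 \<le> C" "\<And>W. integrable M W \<Longrightarrow> norm (defect \<phi> W) \<le> C * (LINT z|M. norm (W z))"
        using defect_L1[OF \<phi>] by metis
      define m where "m = measure M (space M) + 1"
      have "norm (defect \<phi> G) \<le> C * (m * Lp_norm p M (\<lambda>z. F n z - G z))" for n
      proof -
        have D: "(\<lambda>z. G z - F n z) \<in> Lp_fun p M" by (intro Lp_diff p FLp 8(2))
        \<comment> \<open>The approximants have defect 0, so by additivity the defect of
          \<open>G\<close> is that of the difference, which is small in L_1.\<close>
        have "defect \<phi> G = defect \<phi> (\<lambda>z. G z - F n z)"
          using defect_add[OF \<phi> D FLp[of n]] 8(1)[of n] \<phi> by simp
        also have "norm \<dots> \<le> C * (LINT z|M. norm (G z - F n z))"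
          by (rule C(2)[OF L1(1)[OF D]])
        also have "\<dots> \<le> C * (m * Lp_norm p M (\<lambda>z. G z - F n z))"
          unfolding m_def by (intro mult_left_mono L1(2)[OF D] C(1))
        finally show ?thesis by (simp add: Lp_norm_diff_commute[of p M G])
      qed
      moreover have "(\<lambda>n. C * (m * Lp_norm p M (\<lambda>z. F n z - G z))) \<longlonglongrightarrow> C * (m * 0)"
        by (intro tendsto_intros 8(3))
      ultimately have "norm (defect \<phi> G) \<le> C * (m * 0)" by (intro LIMSEQ_le_const) auto
      then show ?thesis by simp
    qed
    then show ?case using 8(2) by simp
  qed (use p \<Omega> in auto)
qed

end

theorem theorem16:
  fixes \<Omega> :: "complex set" and a b :: "complex \<Rightarrow> bicomplex"
  assumes "open \<Omega>" and "connected \<Omega>" and "\<Omega> \<noteq> {}" and "bounded \<Omega>" and "simply_connected \<Omega>"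
    and "a \<in> bc_valued (Lp_fun \<infinity> (lebesgue_on \<Omega>))"
    and "b \<in> bc_valued (Lp_fun \<infinity> (lebesgue_on \<Omega>))"
  shows "(\<forall>p::ennreal. 1 < p \<and> p \<le> \<infinity> \<longrightarrow> complex_banach_space (vekua_bergman p a b \<Omega>)) \<and>
    (\<forall>p::ennreal. 1 < p \<and> p < \<infinity> \<longrightarrow>
      ns_separable (vekua_bergman p a b \<Omega>) \<and> ns_reflexive (vekua_bergman p a b \<Omega>)) \<and>
    complex_hilbert_space (vekua_bergman 2 a b \<Omega>) (bc_L2_inner \<Omega>) \<and>
    ns_separable (vekua_bergman 2 a b \<Omega>)"
proof -
  \<comment> \<open>Openness of \<open>\<Omega>\<close> enters as Lebesgue measurability.\<close>
  interpret vekua \<Omega> a b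
    using assms by unfold_locales (simp_all add: bc_valued_Lp_fun)
  have X: "closed_bc_Lp_subspace.X p \<Omega> (vekua_bergman_functions p a b \<Omega>) = vekua_bergman p a b \<Omega>" if "1 < p" for p
    using closed_bc_Lp_subspace.X_def[OF closed_subspace[OF that]] by (simp add: vekua_bergman_def)
  have two: "1 < (2::ennreal)" "(2::ennreal) < \<infinity>" by simp_all
  note facts = closed_bc_Lp_subspace.banach_X closed_bc_Lp_subspace.separable_X closed_bc_Lp_subspace.reflexive_X
    hilbert_closed_bc_Lp_subspace
  show ?thesis
    using facts(1)[OF closed_subspace] facts(2,3)[OF closed_subspace] facts(4)[OF closed_subspace] two
    by (simp add: X)
qed

end
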